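(* Let $(\mathcal{U},\|\cdot\|_{\mathcal{U}})$ be a Banach ideal of $N$-linear mappings, let $X_1,\dots,X_N$ be uniformly convex Banach spaces and let $\mathbf{X}=X_1\times\cdots\times X_N$. Then $\mathcal{U}(\mathbf{X};Y)$ has the weak Bishop-Phelps-Bollobás property (weak $BPBp$) for every Banach space $Y$.
   Context: Notation: $\mathbb{K}$ is the scalar field ($\mathbb{R}$ or $\mathbb{C}$), $S_X$ the unit sphere of $X$. For $\mathbf{X}=X_1\times\cdots\times X_N$, $\mathcal{L}(^N\mathbf{X};Y)$ is the space of continuous $N$-linear mappings $\mathbf{X}\to Y$ with the supremum norm $\|\cdot\|$; $S_{\mathbf{X}}=S_{X_1}\times\cdots\times S_{X_N}$, with distances measured in the norm $\|\mathbf{x}\|=\max_j\|x_j\|$. Ideal of $N$-linear mappings: a normed ideal of $N$-linear mappings is a pair $(\mathcal{U},\|\cdot\|_{\mathcal{U}})$ such that for every $N$-tuple of Banach spaces $\mathbf{X}$: (i) for every Banach space $Y$, $\mathcal{U}(\mathbf{X};Y)=\mathcal{U}\cap\mathcal{L}(^N\mathbf{X};Y)$ is a linear subspace of $\mathcal{L}(^N\mathbf{X};Y)$ and $\|\cdot\|_{\mathcal{U}}$ is a norm on it; (ii) for all Banach spaces $Z_1,\dots,Z_N,Y,W$, bounded linear operators $T_i:Z_i\to X_i$, $S:Y\to W$ and $\Phi\in\mathcal{U}(\mathbf{X};Y)$, the mapping $S\circ\Phi\circ(T_1,\dots,T_N)$ belongs to $\mathcal{U}(Z_1\times\cdots\times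 Z_N;W)$ with $\|S\circ\Phi\circ(T_1,\dots,T_N)\|_{\mathcal{U}}\le\|S\|\|\Phi\|_{\mathcal{U}}\|T_1\|\cdots\|T_N\|$; (iii) $(z_1,\dots,z_N)\mapsto z_1\cdots z_N$ belongs to $\mathcal{U}(\mathbb{K}^N;\mathbb{K})$ and has $\mathcal{U}$-norm one. It is a Banach ideal if every $(\mathcal{U}(\mathbf{X};Y),\|\cdot\|_{\mathcal{U}})$ is complete. Uniformly convex: for every $\varepsilon>0$ there is $0<\delta<1$ such that $x_1,x_2\in B_X$ and $\frac{\|x_1+x_2\|}{2}>1-\delta$ imply $\|x_1-x_2\|<\varepsilon$. Weak $BPBp$: $\mathcal{U}(\mathbf{X};Y)$ has the weak $BPBp$ if there are positive functions $\tilde\beta(\varepsilon,t)$ and $\tilde\eta(\varepsilon,t)$ of $\varepsilon>0$ and $t>0$, with $\lim_{\varepsilon\to0^+}\tilde\beta(\varepsilon,t)=0$ for each $t$, such that for every $\varepsilon>0$: whenever $\Phi\in\mathcal{U}(\mathbf{X};Y)$, $\|\Phi\|=1$, and $\tilde{\mathbf{x}}\in S_{\mathbf{X}}$ satisfy $\|\Phi(\tilde{\mathbf{x}})\|>1-\tilde\eta(\varepsilon,\|\Phi\|_{\mathcal{U}})$, there exist $\Psi\in\mathcal{U}(\mathbf{X};Y)$ with $\|\Psi\|=1$ and $\mathbf{a}\in S_{\mathbf{X}}$ such that $\|\Psi(\mathbf{a})\|=1$, $\|\mathbf{a}-\tilde{\mathbf{x}}\|<\tilde\beta(\varepsilon,\|\Phi\|_{\mathcal{U}})$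 and $\|\Psi-\Phi\|_{\mathcal{U}}<\varepsilon$. *)

theory Defs
  imports "HOL-Analysis.Analysis" "HOL-Algebra.Module"
begin

section \<open>Banach spaces as structures on a universe\<close>

text \<open>
  An ideal of multilinear mappings ranges over all Banach spaces at once, so Banach spaces are
  structures with an explicit carrier rather than instances of a type class.  The scalar field is
  a set of complex numbers, meant to be either the reals or everything; only scalar multiplication
  by elements of it is constrained.
\<close>

record 'a nspace = "(complex, 'a) module" +
  nrm :: "'a \<Rightarrow> real"

definition scalar_ring :: "complex set \<Rightarrow> complex ring" where
  "scalar_ring K = \<lparr>carrier = K, mult = (*), one = 1, zero = 0, add = (+)\<rparr>"

locale normed_space = module "scalar_ring K" X
  for K :: "complex set" and X :: "'a nspace" (structure) +
  assumes nrm_nonneg: "x \<in> carrier X \<Longrightarrow> 0 \<le> nrm X x"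
    and nrm_eq_0_iff: "x \<in> carrier X \<Longrightarrow> nrm X x = 0 \<longleftrightarrow> x = \<zero>\<^bsub>X\<^esub>"
    and nrm_triangle:
      "\<lbrakk>x \<in> carrier X; y \<in> carrier X\<rbrakk> \<Longrightarrow> nrm X (x \<oplus>\<^bsub>X\<^esub> y) \<le> nrm X x + nrm X y"
    and nrm_smult:
      "\<lbrakk>c \<in> K; x \<in> carrier X\<rbrakk> \<Longrightarrow> nrm X (c \<odot>\<^bsub>X\<^esub> x) = cmod c * nrm X x"

text \<open>
  The locale \<^locale>\<open>Metric_space\<close> asks for symmetry and nonnegativity of the distance also
  outside the carrier, hence the case distinction.
\<close>

definition ndist :: "'a nspace \<Rightarrow> 'a \<Rightarrow> 'a \<Rightarrow> real" where
  "ndist X x y = (if x \<in> carrier X \<and> y \<in> carrier X then nrm X (x \<ominus>\<^bsub>X\<^esub> y) else 0)"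

locale banach_space = normed_space K X
  for K :: "complex set" and X :: "'a nspace" (structure) +
  assumes complete: "Metric_space.mcomplete (carrier X) (ndist X)"

definition ntopology :: "'a nspace \<Rightarrow> 'a topology" where
  "ntopology X = Metric_space.mtopology (carrier X) (ndist X)"

definition unit_ball :: "'a nspace \<Rightarrow> 'a set" where
  "unit_ball X = {x \<in> carrier X. nrm X x \<le> 1}"

definition unit_sphere :: "'a nspace \<Rightarrow> 'a set" where
  "unit_sphere X = {x \<in> carrier X. nrm X x = 1}"

definition uniformly_convex :: "'a nspace \<Rightarrow> bool" where
  "uniformly_convex X \<longleftrightarrow>
    (\<forall>\<epsilon>>0. \<exists>\<delta>. 0 < \<delta> \<and> \<delta> < 1 \<and>
      (\<forall>x1\<in>unit_ball X. \<forall>x2\<in>unit_ball X.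
        nrm X (x1 \<oplus>\<^bsub>X\<^esub> x2) / 2 > 1 - \<delta> \<longrightarrow> nrm X (x1 \<ominus>\<^bsub>X\<^esub> x2) < \<epsilon>))"

definition bounded_operator :: "complex set \<Rightarrow> 'a nspace \<Rightarrow> 'b nspace \<Rightarrow> ('a \<Rightarrow> 'b) \<Rightarrow> bool" where
  "bounded_operator K X Y T \<longleftrightarrow>
    T \<in> carrier X \<rightarrow> carrier Y \<and>
    (\<forall>x\<in>carrier X. \<forall>y\<in>carrier X. T (x \<oplus>\<^bsub>X\<^esub> y) = T x \<oplus>\<^bsub>Y\<^esub> T y) \<and>
    (\<forall>c\<in>K. \<forall>x\<in>carrier X. T (c \<odot>\<^bsub>X\<^esub> x) = c \<odot>\<^bsub>Y\<^esub> T x) \<and>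
    (\<exists>C. \<forall>x\<in>carrier X. nrm Y (T x) \<le> C * nrm X x)"

definition operator_norm :: "'a nspace \<Rightarrow> 'b nspace \<Rightarrow> ('a \<Rightarrow> 'b) \<Rightarrow> real" where
  "operator_norm X Y T = (SUP x\<in>unit_ball X. nrm Y (T x))"


section \<open>Multilinear mappings\<close>

text \<open>
  The number of factors is the cardinality of the finite (nonempty) index type \<^typ>\<open>'n\<close>.
  Mappings are extensional, so that they are determined by their values on the product.
\<close>

definition tuples :: "('n \<Rightarrow> 'a nspace) \<Rightarrow> ('n \<Rightarrow> 'a) set" where
  "tuples X = (\<Pi>\<^sub>E i\<in>UNIV. carrier (X i))"

definition sphere_tuples :: "('n \<Rightarrow> 'a nspace) \<Rightarrow> ('n \<Rightarrow> 'a) set" where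
  "sphere_tuples X = (\<Pi>\<^sub>E i\<in>UNIV. unit_sphere (X i))"

definition tuple_dist :: "('n::finite \<Rightarrow> 'a nspace) \<Rightarrow> ('n \<Rightarrow> 'a) \<Rightarrow> ('n \<Rightarrow> 'a) \<Rightarrow> real" where
  "tuple_dist X x y = (MAX i. nrm (X i) (x i \<ominus>\<^bsub>X i\<^esub> y i))"

definition continuous_multilinear ::
    "complex set \<Rightarrow> ('n::finite \<Rightarrow> 'a nspace) \<Rightarrow> 'b nspace \<Rightarrow> (('n \<Rightarrow> 'a) \<Rightarrow> 'b) \<Rightarrow> bool" where
  "continuous_multilinear K X Y \<Phi> \<longleftrightarrow>
    \<Phi> \<in> tuples X \<rightarrow>\<^sub>E carrier Y \<and>
    (\<forall>x\<in>tuples X. \<forall>i. \<forall>u\<in>carrier (X i). \<forall>v\<in>carrier (X i).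
      \<Phi> (x(i := u \<oplus>\<^bsub>X i\<^esub> v)) = \<Phi> (x(i := u)) \<oplus>\<^bsub>Y\<^esub> \<Phi> (x(i := v))) \<and>
    (\<forall>x\<in>tuples X. \<forall>i. \<forall>c\<in>K. \<forall>u\<in>carrier (X i).
      \<Phi> (x(i := c \<odot>\<^bsub>X i\<^esub> u)) = c \<odot>\<^bsub>Y\<^esub> \<Phi> (x(i := u))) \<and>
    continuous_map (product_topology (\<lambda>i. ntopology (X i)) UNIV) (ntopology Y) \<Phi>"

definition sup_norm :: "('n::finite \<Rightarrow> 'a nspace) \<Rightarrow> 'b nspace \<Rightarrow> (('n \<Rightarrow> 'a) \<Rightarrow> 'b) \<Rightarrow> real" where
  "sup_norm X Y \<Phi> = (SUP x\<in>(\<Pi>\<^sub>E i\<in>UNIV. unit_ball (X i)). nrm Y (\<Phi> x))"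

text \<open>
  The fields \<^const>\<open>mult\<close> and \<^const>\<open>one\<close> come with the module record of the
  library but play no role in a module.
\<close>

definition multilinear_space ::
    "complex set \<Rightarrow> ('n::finite \<Rightarrow> 'a nspace) \<Rightarrow> 'b nspace \<Rightarrow> (('n \<Rightarrow> 'a) \<Rightarrow> 'b) nspace" where
  "multilinear_space K X Y =
    \<lparr>carrier = {\<Phi>. continuous_multilinear K X Y \<Phi>},
     mult = undefined, one = undefined,
     zero = (\<lambda>x\<in>tuples X. \<zero>\<^bsub>Y\<^esub>),
     add = (\<lambda>\<Phi> \<Psi>. \<lambda>x\<in>tuples X. \<Phi> x \<oplus>\<^bsub>Y\<^esub> \<Psi> x),
     smult = (\<lambda>c \<Phi>. \<lambda>x\<in>tuples X. c \<odot>\<^bsub>Y\<^esub> \<Phi> x),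
     nrm = sup_norm X Y\<rparr>"


section \<open>Ideals of multilinear mappings\<close>

text \<open>
  The Banach spaces in play are those with carrier in \<^typ>\<open>complex + 'u\<close>, where the type
  \<^typ>\<open>'u\<close> is arbitrary: the left summand hosts the scalar field as a Banach space over
  itself, while a Banach space with elements in \<^typ>\<open>'u\<close> lives in the right summand.
\<close>

type_synonym 'u bspace = "(complex + 'u) nspace"

type_synonym ('n, 'u) mapping = "('n \<Rightarrow> complex + 'u) \<Rightarrow> complex + 'u"

definition scalar_space :: "complex set \<Rightarrow> 'u bspace" where
  "scalar_space K =
    \<lparr>carrier = Inl ` K,
     mult = undefined, one = undefined,
     zero = Inl 0,
     add = (\<lambda>x y. Inl (projl x + projl y)),
     smult = (\<lambda>c x. Inl (c * projl x)),
     nrm = (\<lambda>x. cmod (projl x))\<rparr>"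

definition scalar_product_map :: "complex set \<Rightarrow> ('n::finite, 'u) mapping" where
  "scalar_product_map K =
    (\<lambda>z\<in>tuples (\<lambda>_::'n. scalar_space K). Inl (\<Prod>i\<in>UNIV. projl (z i)))"

text \<open>
  A candidate ideal is given by its components \<^term>\<open>\<U> X Y\<close> together with the
  functions \<^term>\<open>\<nu> X Y\<close> that measure the ideal norm on them.
\<close>

definition ideal_space ::
    "(('n::finite \<Rightarrow> 'u bspace) \<Rightarrow> 'u bspace \<Rightarrow> ('n, 'u) mapping set) \<Rightarrow>
     (('n \<Rightarrow> 'u bspace) \<Rightarrow> 'u bspace \<Rightarrow> ('n, 'u) mapping \<Rightarrow> real) \<Rightarrow>
     complex set \<Rightarrow> ('n \<Rightarrow> 'u bspace) \<Rightarrow> 'u bspace \<Rightarrow> ('n, 'u) mapping nspace" where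
  "ideal_space \<U> \<nu> K X Y = (multilinear_space K X Y)\<lparr>carrier := \<U> X Y, nrm := \<nu> X Y\<rparr>"

definition normed_ideal ::
    "complex set \<Rightarrow> (('n::finite \<Rightarrow> 'u bspace) \<Rightarrow> 'u bspace \<Rightarrow> ('n, 'u) mapping set) \<Rightarrow>
     (('n \<Rightarrow> 'u bspace) \<Rightarrow> 'u bspace \<Rightarrow> ('n, 'u) mapping \<Rightarrow> real) \<Rightarrow> bool" where
  "normed_ideal K \<U> \<nu> \<longleftrightarrow>
    (\<forall>X Y. (\<forall>i. banach_space K (X i)) \<longrightarrow> banach_space K Y \<longrightarrow>
      submodule (\<U> X Y) (scalar_ring K) (multilinear_space K X Y) \<and>
      normed_space K (ideal_space \<U> \<nu> K X Y)) \<and>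
    (\<forall>X Z Y W T S \<Phi>.
      (\<forall>i. banach_space K (X i)) \<longrightarrow> (\<forall>i. banach_space K (Z i)) \<longrightarrow>
      banach_space K Y \<longrightarrow> banach_space K W \<longrightarrow>
      (\<forall>i. bounded_operator K (Z i) (X i) (T i)) \<longrightarrow> bounded_operator K Y W S \<longrightarrow>
      \<Phi> \<in> \<U> X Y \<longrightarrow>
      (\<lambda>z\<in>tuples Z. S (\<Phi> (\<lambda>i. T i (z i)))) \<in> \<U> Z W \<and>
      \<nu> Z W (\<lambda>z\<in>tuples Z. S (\<Phi> (\<lambda>i. T i (z i))))
        \<le> operator_norm Y W S * \<nu> X Y \<Phi> * (\<Prod>i\<in>UNIV. operator_norm (Z i) (X i) (T i))) \<and>
    scalar_product_map K \<in> \<U> (\<lambda>_. scalar_space K) (scalar_space K) \<and>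
    \<nu> (\<lambda>_. scalar_space K) (scalar_space K) (scalar_product_map K) = 1"

definition banach_ideal ::
    "complex set \<Rightarrow> (('n::finite \<Rightarrow> 'u bspace) \<Rightarrow> 'u bspace \<Rightarrow> ('n, 'u) mapping set) \<Rightarrow>
     (('n \<Rightarrow> 'u bspace) \<Rightarrow> 'u bspace \<Rightarrow> ('n, 'u) mapping \<Rightarrow> real) \<Rightarrow> bool" where
  "banach_ideal K \<U> \<nu> \<longleftrightarrow>
    normed_ideal K \<U> \<nu> \<and>
    (\<forall>X Y. (\<forall>i. banach_space K (X i)) \<longrightarrow> banach_space K Y \<longrightarrow>
      banach_space K (ideal_space \<U> \<nu> K X Y))"

definition weak_BPBp ::
    "complex set \<Rightarrow> (('n::finite \<Rightarrow> 'u bspace) \<Rightarrow> 'u bspace \<Rightarrow> ('n, 'u) mapping set) \<Rightarrow>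
     (('n \<Rightarrow> 'u bspace) \<Rightarrow> 'u bspace \<Rightarrow> ('n, 'u) mapping \<Rightarrow> real) \<Rightarrow>
     ('n \<Rightarrow> 'u bspace) \<Rightarrow> 'u bspace \<Rightarrow> bool" where
  "weak_BPBp K \<U> \<nu> X Y \<longleftrightarrow>
    (\<exists>\<beta> \<eta> :: real \<Rightarrow> real \<Rightarrow> real.
      (\<forall>\<epsilon>>0. \<forall>t>0. \<beta> \<epsilon> t > 0 \<and> \<eta> \<epsilon> t > 0) \<and>
      (\<forall>t>0. ((\<lambda>\<epsilon>. \<beta> \<epsilon> t) \<longlongrightarrow> 0) (at_right 0)) \<and>
      (\<forall>\<epsilon>>0. \<forall>\<Phi>\<in>\<U> X Y. \<forall>x\<in>sphere_tuples X.
        sup_norm X Y \<Phi> = 1 \<longrightarrow> nrm Y (\<Phi> x) > 1 - \<eta> \<epsilon> (\<nu> X Y \<Phi>) \<longrightarrow>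
        (\<exists>\<Psi>\<in>\<U> X Y. \<exists>a\<in>sphere_tuples X.
          sup_norm X Y \<Psi> = 1 \<and> nrm Y (\<Psi> a) = 1 \<and>
          tuple_dist X a x < \<beta> \<epsilon> (\<nu> X Y \<Phi>) \<and>
          \<nu> X Y (\<Psi> \<ominus>\<^bsub>ideal_space \<U> \<nu> K X Y\<^esub> \<Phi>) < \<epsilon>)))"

end

theory Submission
  imports Defs "HOL-Real_Asymp.Real_Asymp"
begin

text \<open>
  Given \<open>\<Phi>\<close> nearly attaining its norm at \<open>x\<close>, choose functionals \<open>\<phi>\<^sub>i\<close> of norm one with
  \<open>\<phi>\<^sub>i x\<^sub>i = 1\<close> and add the small multiple \<open>e \<phi>\<^sub>1 \<cdots> \<phi>\<^sub>N \<Phi>(x)\<close>, whose ideal norm is at most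
  \<open>e \<parallel>\<Phi>(x)\<parallel>\<close>.  A point \<open>x'\<close> where the perturbed mapping nearly attains its norm, suitably
  rotated, has every \<open>\<phi>\<^sub>i x'\<^sub>i\<close> close to one, so uniform convexity puts \<open>x'\<close> close to \<open>x\<close>.
  Iterating with geometrically decreasing errors gives mappings that converge in the ideal norm,
  hence in the supremum norm, and points that converge to one where the limit attains its norm.
  Rescaling the limit to norm one costs an error proportional to \<open>\<parallel>\<Phi>\<parallel>\<^sub>\<U>\<close>; this is the only
  dependence of \<open>\<eta>\<close> on the ideal norm, and \<open>\<beta>(\<epsilon>, t) = \<epsilon>\<close> suffices.
\<close>

section \<open>Normed spaces\<close>

text \<open>The perturbation localizes the new point through its gain. At \<open>x\<close> the added
  term raises the norm by the full factor 1 + e, while at \<open>x'\<close> it contributes at most e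
  times the product of the moduli of the values of the functionals. A near-maximizer must recover
  almost all of that gain, so this product is close to one, provided that the defect of the mapping
  at \<open>x\<close> is small compared with e. The size of a perturbation thus dictates the defect
  it tolerates, and each stage must hand the next one a point whose defect was prescribed
  beforehand. Hence the single step delivers a point for every tolerance, and all tolerances are
  fixed before the iteration starts. No intermediate mapping is claimed to attain its norm; only the
  limit does. The ideal axioms supply just one explicit mapping of known ideal norm, the product of
  scalars. Composing from it gives the rank-one correction; composing down to it shows that the
  ideal norm dominates the supremum norm. Norming functionals enter both times, which is why a
  Hahn-Banach argument on spaces with explicit carrier precedes the rest.\<close>

lemma scalar_ring_simps [simp]:
  "carrier (scalar_ring K) = K"
  "x \<otimes>\<^bsub>scalar_ring K\<^esub> y = x * y"
  "x \<oplus>\<^bsub>scalar_ring K\<^esub> y = x + y"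
  "\<one>\<^bsub>scalar_ring K\<^esub> = 1"
  "\<zero>\<^bsub>scalar_ring K\<^esub> = 0"
  by (simp_all add: scalar_ring_def)

locale real_or_complex =
  fixes K :: "complex set"
  assumes real_or_complex: "K = \<real> \<or> K = UNIV"
begin

lemma of_real_in_scalars [simp, intro]: "of_real r \<in> K"
  using real_or_complex by auto

lemma scalars_0_1 [simp, intro]: "0 \<in> K" "1 \<in> K"
  using real_or_complex by auto

lemma scalars_closed_arith [intro]:
  "a \<in> K \<Longrightarrow> b \<in> K \<Longrightarrow> a + b \<in> K"
  "a \<in> K \<Longrightarrow> b \<in> K \<Longrightarrow> a * b \<in> K"
  "a \<in> K \<Longrightarrow> b \<in> K \<Longrightarrow> a / b \<in> K"
  "a \<in> K \<Longrightarrow> - a \<in> K"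
  "a \<in> K \<Longrightarrow> cnj a \<in> K"
  "a \<in> K \<Longrightarrow> sgn a \<in> K"
  using real_or_complex by (auto simp: sgn_eq Reals_cnj_iff)

lemma scalars_prod: "(\<And>i. i \<in> I \<Longrightarrow> f i \<in> K) \<Longrightarrow> prod f I \<in> K"
  using real_or_complex by (auto intro: prod_in_Reals)

lemma closed_scalars: "closed K"
  using real_or_complex closed_complex_Reals by auto

lemma cring_scalar_ring: "cring (scalar_ring K)"
proof (rule cringI)
  show "abelian_group (scalar_ring K)"
  proof (rule abelian_groupI)
    fix x assume "x \<in> carrier (scalar_ring K)"
    then show "\<exists>y\<in>carrier (scalar_ring K). y \<oplus>\<^bsub>scalar_ring K\<^esub> x = \<zero>\<^bsub>scalar_ring K\<^esub>"
      by (intro bexI[of _ "- x"]) auto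
  qed auto
  show "comm_monoid (scalar_ring K)"
    by (rule comm_monoidI) auto
qed (auto simp: algebra_simps)

end

section \<open>Norm inequalities and the metric topology on the carrier\<close>

context normed_space
begin

lemma nrm_zero [simp]: "nrm X \<zero> = 0"
  using nrm_eq_0_iff[OF M.zero_closed] by simp

text \<open>In this locale \<open>K\<close> is only known to carry a commutative ring, so -1 is
  obtained as the additive inverse of one in \<open>scalar_ring K\<close>.\<close>

lemma nrm_minus [simp]: "x \<in> carrier X \<Longrightarrow> nrm X (\<ominus> x) = nrm X x"
proof -
  assume x: "x \<in> carrier X"
  have 1: "1 \<in> K" using R.one_closed by simp
  have m: "\<ominus>\<^bsub>scalar_ring K\<^esub> 1 = -1"
    using R.l_neg[of 1] 1 by (simp add: eq_neg_iff_add_eq_0)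
  have "-1 \<in> K" using R.a_inv_closed[of 1] 1 m by simp
  then show ?thesis
    using smult_l_minus[of 1 x] nrm_smult[of "-1" x] x 1 m smult_one[OF x] by simp
qed

lemma nrm_diff_commute:
  "x \<in> carrier X \<Longrightarrow> y \<in> carrier X \<Longrightarrow> nrm X (x \<ominus> y) = nrm X (y \<ominus> x)"
proof -
  assume x: "x \<in> carrier X" and y: "y \<in> carrier X"
  then have "\<ominus> (x \<ominus> y) = y \<ominus> x"
    by (simp add: a_minus_def M.minus_add M.a_comm)
  then show ?thesis using nrm_minus[of "x \<ominus> y"] x y by simp
qed

lemma nrm_diff_triangle:
  assumes "x \<in> carrier X" "y \<in> carrier X" "z \<in> carrier X"
  shows "nrm X (x \<ominus> z) \<le> nrm X (x \<ominus> y) + nrm X (y \<ominus> z)"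
proof -
  have "x \<ominus> z = (x \<ominus> y) \<oplus> (y \<ominus> z)"
    using assms by (simp add: a_minus_def M.a_assoc M.r_neg1)
  then show ?thesis using nrm_triangle[of "x \<ominus> y" "y \<ominus> z"] assms by simp
qed

lemma diff_add_cancel: "x \<in> carrier X \<Longrightarrow> y \<in> carrier X \<Longrightarrow> (x \<ominus> y) \<oplus> y = x"
  by (simp add: a_minus_def M.a_assoc M.l_neg)

lemma add_diff_cancel: "x \<in> carrier X \<Longrightarrow> y \<in> carrier X \<Longrightarrow> (x \<oplus> y) \<ominus> x = y"
  by (simp add: a_minus_def M.a_comm[of x y] M.a_assoc M.r_neg)

lemma nrm_reverse_triangle:
  "x \<in> carrier X \<Longrightarrow> y \<in> carrier X \<Longrightarrow> \<bar>nrm X x - nrm X y\<bar> \<le> nrm X (x \<ominus> y)"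
  using nrm_triangle[of "x \<ominus> y" y] nrm_triangle[of "y \<ominus> x" x]
  by (simp add: diff_add_cancel nrm_diff_commute[of x y])

lemma diff_self: "x \<in> carrier X \<Longrightarrow> x \<ominus> x = \<zero>"
  by (simp add: a_minus_def M.r_neg)

lemma diff_eq_0_imp_eq: "x \<in> carrier X \<Longrightarrow> y \<in> carrier X \<Longrightarrow> x \<ominus> y = \<zero> \<Longrightarrow> x = y"
  using diff_add_cancel[of x y] by simp

lemma Metric_space_ndist: "Metric_space (carrier X) (ndist X)"
proof
  fix x y z
  show "0 \<le> ndist X x y" by (simp add: ndist_def nrm_nonneg)
  show "ndist X x y = ndist X y x" by (simp add: ndist_def nrm_diff_commute)
  show "ndist X x z \<le> ndist X x y + ndist X y z"
    if "x \<in> carrier X" "y \<in> carrier X" "z \<in> carrier X"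
    using that nrm_diff_triangle by (simp add: ndist_def)
  show "(ndist X x y = 0) = (x = y)" if "x \<in> carrier X" "y \<in> carrier X"
    using that nrm_eq_0_iff[of "x \<ominus> y"] diff_eq_0_imp_eq[of x y] diff_self
    by (auto simp: ndist_def)
qed

lemma topspace_ntopology [simp]: "topspace (ntopology X) = carrier X"
  unfolding ntopology_def
  by (rule Metric_space.topspace_mtopology[OF Metric_space_ndist])

lemma limitin_ntopology:
  assumes "\<And>k. \<sigma> k \<in> carrier X"
  shows "limitin (ntopology X) \<sigma> l sequentially \<longleftrightarrow>
    l \<in> carrier X \<and> (\<lambda>k. nrm X (\<sigma> k \<ominus> l)) \<longlonglongrightarrow> 0"
  unfolding ntopology_def Metric_space.limitin_metric_dist_null[OF Metric_space_ndist]
  using assms by (auto simp: ndist_def)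

lemma tendsto_nrm:
  assumes "\<And>k. \<sigma> k \<in> carrier X" "limitin (ntopology X) \<sigma> l sequentially"
  shows "(\<lambda>k. nrm X (\<sigma> k)) \<longlonglongrightarrow> nrm X l"
proof -
  have l: "l \<in> carrier X" "(\<lambda>k. nrm X (\<sigma> k \<ominus> l)) \<longlonglongrightarrow> 0"
    using assms limitin_ntopology by blast+
  have "norm (nrm X (\<sigma> k) - nrm X l) \<le> nrm X (\<sigma> k \<ominus> l)" for k
    using nrm_reverse_triangle[OF assms(1) l(1)] by simp
  then have "(\<lambda>k. nrm X (\<sigma> k) - nrm X l) \<longlonglongrightarrow> 0"
    by (intro Lim_null_comparison[OF _ l(2)]) simp
  then show ?thesis using LIM_zero_iff by blast
qed

end

text \<open>The error bound holds from every index on. Index 0 bounds the total displacement of the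
  iteration, and large indices give the rate at which the limit is approached.\<close>

lemma (in banach_space) geometric_convergence:
  assumes \<sigma>: "\<And>k. \<sigma> k \<in> carrier X"
    and step: "\<And>k. nrm X (\<sigma> (Suc k) \<ominus> \<sigma> k) \<le> r / 2 ^ k"
  obtains l where "l \<in> carrier X" "limitin (ntopology X) \<sigma> l sequentially"
    "\<And>k. nrm X (\<sigma> k \<ominus> l) \<le> 2 * r / 2 ^ k"
proof -
  have r: "0 \<le> r" using step[of 0] nrm_nonneg[of "\<sigma> 1 \<ominus> \<sigma> 0"] \<sigma> by simp
  \<comment> \<open>The right-hand side is the exact geometric sum of the steps k, ..., k + j - 1,
    which lets the induction on j close without loss.\<close>
  have tail: "nrm X (\<sigma> (k + j) \<ominus> \<sigma> k) \<le> 2 * r / 2 ^ k - 2 * r / 2 ^ (k + j)" for k j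
  proof (induction j)
    case 0
    show ?case using \<sigma> by (simp add: diff_self)
  next
    case (Suc j)
    have "nrm X (\<sigma> (k + Suc j) \<ominus> \<sigma> k)
        \<le> nrm X (\<sigma> (Suc (k + j)) \<ominus> \<sigma> (k + j)) + nrm X (\<sigma> (k + j) \<ominus> \<sigma> k)"
      using nrm_diff_triangle \<sigma> by simp
    also have "\<dots> \<le> r / 2 ^ (k + j) + (2 * r / 2 ^ k - 2 * r / 2 ^ (k + j))"
      using step Suc by (intro add_mono) auto
    also have "\<dots> = 2 * r / 2 ^ k - 2 * r / 2 ^ (k + Suc j)"
      by (simp add: field_simps)
    finally show ?case .
  qed
  have tail': "nrm X (\<sigma> n \<ominus> \<sigma> k) \<le> 2 * r / 2 ^ k" if "k \<le> n" for n k
  proof -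
    have "nrm X (\<sigma> n \<ominus> \<sigma> k) \<le> 2 * r / 2 ^ k - 2 * r / 2 ^ n"
      using tail[of k "n - k"] that by simp
    also have "\<dots> \<le> 2 * r / 2 ^ k" using r by simp
    finally show ?thesis .
  qed
  have vanish: "(\<lambda>k. 2 * r / 2 ^ k) \<longlonglongrightarrow> 0"
    by real_asymp
  interpret Metric_space "carrier X" "ndist X" by (rule Metric_space_ndist)
  have "MCauchy \<sigma>"
    unfolding MCauchy_def
  proof (intro conjI allI impI)
    show "range \<sigma> \<subseteq> carrier X" using \<sigma> by auto
    fix e :: real assume "e > 0"
    then have "\<forall>\<^sub>F k in sequentially. 2 * r / 2 ^ k < e / 2"
      using order_tendstoD(2)[OF vanish, of "e / 2"] by simp
    then obtain N where N: "2 * r / 2 ^ N < e / 2"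
      unfolding eventually_sequentially by blast
    show "\<exists>N. \<forall>n n'. N \<le> n \<longrightarrow> N \<le> n' \<longrightarrow> ndist X (\<sigma> n) (\<sigma> n') < e"
    proof (intro exI[of _ N] allI impI)
      fix n n' assume "N \<le> n" "N \<le> n'"
      then have "nrm X (\<sigma> n \<ominus> \<sigma> N) < e / 2" "nrm X (\<sigma> n' \<ominus> \<sigma> N) < e / 2"
        using tail'[of N n] tail'[of N n'] N by linarith+
      then show "ndist X (\<sigma> n) (\<sigma> n') < e"
        using nrm_diff_triangle[of "\<sigma> n" "\<sigma> N" "\<sigma> n'"] \<sigma>
        by (simp add: ndist_def nrm_diff_commute[of "\<sigma> n'" "\<sigma> N"])
    qed
  qed
  then obtain l where lim: "limitin mtopology \<sigma> l sequentially"
    using complete mcomplete_def by blast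
  then have lim': "limitin (ntopology X) \<sigma> l sequentially" by (simp add: ntopology_def)
  then have l: "l \<in> carrier X" and null: "(\<lambda>k. nrm X (\<sigma> k \<ominus> l)) \<longlonglongrightarrow> 0"
    using limitin_ntopology[of \<sigma>, OF \<sigma>] by auto
  have "nrm X (\<sigma> k \<ominus> l) \<le> 2 * r / 2 ^ k" for k
  proof -
    have "nrm X (\<sigma> k \<ominus> l) \<le> 2 * r / 2 ^ k + nrm X (\<sigma> n \<ominus> l)" if "n \<ge> k" for n
      using nrm_diff_triangle[of "\<sigma> k" "\<sigma> n" l] tail'[OF that] \<sigma> l
      by (simp add: nrm_diff_commute[of "\<sigma> k" "\<sigma> n"])
    moreover have "(\<lambda>n. 2 * r / 2 ^ k + nrm X (\<sigma> n \<ominus> l)) \<longlonglongrightarrow> 2 * r / 2 ^ k + 0"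
      by (intro tendsto_intros null)
    ultimately show ?thesis
      using LIMSEQ_le_const[of _ "2 * r / 2 ^ k + 0" "nrm X (\<sigma> k \<ominus> l)"] by auto
  qed
  then show ?thesis using that l lim' by blast
qed

section \<open>Norming functionals\<close>

locale normed_space_rc = normed_space K X + real_or_complex K
  for K and X :: "'a nspace" (structure)
begin

text \<open>Scaling by reals exists for both choices of \<open>K\<close>, so the Hahn-Banach
  argument can be carried out over the reals for both fields at once.\<close>

definition rmult :: "real \<Rightarrow> 'a \<Rightarrow> 'a" where
  "rmult t x = of_real t \<odot> x"

lemma rmult_closed [simp]: "x \<in> carrier X \<Longrightarrow> rmult t x \<in> carrier X"
  by (simp add: rmult_def)

lemma rmult_add_right:
  "x \<in> carrier X \<Longrightarrow> y \<in> carrier X \<Longrightarrow> rmult t (x \<oplus> y) = rmult t x \<oplus> rmult t y"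
  by (simp add: rmult_def smult_r_distr)

lemma rmult_add_left: "x \<in> carrier X \<Longrightarrow> rmult (s + t) x = rmult s x \<oplus> rmult t x"
  using smult_l_distr[of "of_real s" "of_real t" x] by (simp add: rmult_def)

lemma rmult_rmult: "x \<in> carrier X \<Longrightarrow> rmult s (rmult t x) = rmult (s * t) x"
  using smult_assoc1[of "of_real s" "of_real t" x] by (simp add: rmult_def)

lemma rmult_one [simp]: "x \<in> carrier X \<Longrightarrow> rmult 1 x = x"
  using smult_one by (simp add: rmult_def)

lemma rmult_zero [simp]: "x \<in> carrier X \<Longrightarrow> rmult 0 x = \<zero>"
  using smult_l_null by (simp add: rmult_def)

lemma rmult_null [simp]: "rmult t \<zero> = \<zero>"
  using smult_r_null by (simp add: rmult_def)

lemma rmult_uminus: "x \<in> carrier X \<Longrightarrow> rmult (- t) x = \<ominus> rmult t x"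
  using rmult_add_left[of x "-t" t] by (intro M.minus_equality[symmetric]) simp_all

lemma rmult_diff_self: "x \<in> carrier X \<Longrightarrow> rmult t x \<ominus> x = rmult (t - 1) x"
  using rmult_add_left[of x 1 "t - 1"] add_diff_cancel[of x "rmult (t - 1) x"] by simp

lemma nrm_rmult: "x \<in> carrier X \<Longrightarrow> nrm X (rmult t x) = \<bar>t\<bar> * nrm X x"
  by (simp add: rmult_def nrm_smult)

section \<open>Sublinear functionals and minimal ones among them\<close>

definition sublinear :: "('a \<Rightarrow> real) \<Rightarrow> bool" where
  "sublinear q \<longleftrightarrow>
    (\<forall>x\<in>carrier X. \<forall>y\<in>carrier X. q (x \<oplus> y) \<le> q x + q y) \<and>
    (\<forall>t>0. \<forall>x\<in>carrier X. q (rmult t x) \<le> t * q x)"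

lemma sublinear_add:
  "sublinear q \<Longrightarrow> x \<in> carrier X \<Longrightarrow> y \<in> carrier X \<Longrightarrow> q (x \<oplus> y) \<le> q x + q y"
  by (simp add: sublinear_def)

lemma sublinear_zero:
  assumes "sublinear q" shows "q \<zero> = 0"
proof -
  have "q \<zero> \<le> t * q \<zero>" if "t > 0" for t
    using assms that M.zero_closed rmult_null unfolding sublinear_def by metis
  from this[of 2] this[of "1/2"] show ?thesis by simp
qed

text \<open>Applying the inequality in \<open>sublinear\<close> once with t and once with 1 / t
  gives equality.\<close>

lemma sublinear_rmult:
  assumes q: "sublinear q" and t: "0 \<le> t" and x: "x \<in> carrier X"
  shows "q (rmult t x) = t * q x"
proof (cases "t = 0")
  case True
  then show ?thesis using sublinear_zero[OF q] x by simp
next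
  case False
  then have t: "t > 0" using t by simp
  have "q (rmult (1 / t) (rmult t x)) \<le> (1 / t) * q (rmult t x)"
    using q t rmult_closed[OF x, of t] unfolding sublinear_def by (metis zero_less_divide_1_iff)
  then have "t * q x \<le> q (rmult t x)"
    using t x by (simp add: rmult_rmult field_simps)
  moreover have "q (rmult t x) \<le> t * q x" using q t x by (simp add: sublinear_def)
  ultimately show ?thesis by simp
qed

lemma sublinear_lower:
  assumes "sublinear q" "x \<in> carrier X" shows "- q (\<ominus> x) \<le> q x"
  using sublinear_add[OF assms(1), of x "\<ominus> x"] assms sublinear_zero[OF assms(1)] by (simp add: M.r_neg)

lemma sublinear_nrm: "sublinear (nrm X)"
  by (simp add: sublinear_def nrm_triangle nrm_rmult)

text \<open>The largest sublinear minorant of \<open>q\<close> whose value at the negative of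
  \<open>a\<close> is at most \<open>- q a\<close>, when \<open>q\<close> is sublinear and
  \<open>a\<close> lies in the carrier.\<close>

definition lower_along :: "('a \<Rightarrow> real) \<Rightarrow> 'a \<Rightarrow> 'a \<Rightarrow> real" where
  "lower_along q a x = (INF t\<in>{0..}. q (x \<oplus> rmult t a) - t * q a)"

text \<open>Subadditivity for \<ominus> x and x \<oplus> t a bounds every competitor below by
  \<open>- q (\<ominus> x)\<close>, so the infimum is a genuine one.\<close>

lemma lower_along_le:
  assumes q: "sublinear q" and a: "a \<in> carrier X" and x: "x \<in> carrier X" and t: "0 \<le> t"
  shows "lower_along q a x \<le> q (x \<oplus> rmult t a) - t * q a"
proof -
  have "- q (\<ominus> x) \<le> q (x \<oplus> rmult s a) - s * q a" if "0 \<le> s" for s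
  proof -
    have "\<ominus> x \<oplus> (x \<oplus> rmult s a) = rmult s a" using a x by (simp add: M.r_neg1)
    then show ?thesis
      using sublinear_add[OF q, of "\<ominus> x" "x \<oplus> rmult s a"] sublinear_rmult[OF q that a] a x
      by simp
  qed
  then have "bdd_below ((\<lambda>t. q (x \<oplus> rmult t a) - t * q a) ` {0..})"
    by (intro bdd_belowI[of _ "- q (\<ominus> x)"]) auto
  then show ?thesis unfolding lower_along_def
    by (rule cINF_lower) (use t in simp)
qed

lemma lower_along_greatest:
  "(\<And>t. 0 \<le> t \<Longrightarrow> c \<le> q (x \<oplus> rmult t a) - t * q a) \<Longrightarrow> c \<le> lower_along q a x"
  unfolding lower_along_def by (intro cINF_greatest) auto

lemma lower_along_le_self:
  assumes "sublinear q" "a \<in> carrier X" "x \<in> carrier X"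
  shows "lower_along q a x \<le> q x"
  using lower_along_le[OF assms, of 0] assms by simp

lemma lower_along_minus:
  assumes "sublinear q" "a \<in> carrier X"
  shows "lower_along q a (\<ominus> a) \<le> - q a"
  using lower_along_le[OF assms, of "\<ominus> a" 1] assms sublinear_zero[OF assms(1)] by (simp add: M.l_neg)

text \<open>Parameters s for x and t for y combine to s + t for x \<oplus> y, and a parameter t for
  x becomes c t for the multiple of x by c; the infima are then taken one variable at a
  time.\<close>

lemma sublinear_lower_along:
  assumes q: "sublinear q" and a: "a \<in> carrier X"
  shows "sublinear (lower_along q a)"
  unfolding sublinear_def
proof (intro conjI ballI allI impI)
  fix x y assume x: "x \<in> carrier X" and y: "y \<in> carrier X"
  have le: "lower_along q a (x \<oplus> y)
      \<le> (q (x \<oplus> rmult s a) - s * q a) + (q (y \<oplus> rmult t a) - t * q a)"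
    if "0 \<le> s" "0 \<le> t" for s t
  proof -
    have "(x \<oplus> y) \<oplus> rmult (s + t) a = (x \<oplus> rmult s a) \<oplus> (y \<oplus> rmult t a)"
      using x y a by (simp add: rmult_add_left M.a_ac)
    then show ?thesis
      using lower_along_le[OF q a, of "x \<oplus> y" "s + t"] that x y a
        sublinear_add[OF q, of "x \<oplus> rmult s a" "y \<oplus> rmult t a"]
      by (simp add: algebra_simps)
  qed
  have "lower_along q a (x \<oplus> y) - (q (x \<oplus> rmult s a) - s * q a) \<le> lower_along q a y"
    if "0 \<le> s" for s
    by (rule lower_along_greatest) (use le[OF that] in \<open>simp add: algebra_simps\<close>)
  then have "lower_along q a (x \<oplus> y) - lower_along q a y \<le> lower_along q a x"
    by (intro lower_along_greatest) (simp add: algebra_simps)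
  then show "lower_along q a (x \<oplus> y) \<le> lower_along q a x + lower_along q a y" by simp
next
  fix c :: real and x assume c: "0 < c" and x: "x \<in> carrier X"
  have "lower_along q a (rmult c x) / c \<le> q (x \<oplus> rmult t a) - t * q a" if "0 \<le> t" for t
  proof -
    have "rmult c x \<oplus> rmult (c * t) a = rmult c (x \<oplus> rmult t a)"
      using x a by (simp add: rmult_add_right rmult_rmult)
    then have "lower_along q a (rmult c x) \<le> c * q (x \<oplus> rmult t a) - c * t * q a"
      using lower_along_le[OF q a, of "rmult c x" "c * t"] c that x a
        sublinear_rmult[OF q, of c "x \<oplus> rmult t a"] by simp
    then show ?thesis using c by (simp add: field_simps)
  qed
  then have "lower_along q a (rmult c x) / c \<le> lower_along q a x"
    by (rule lower_along_greatest)
  then show "lower_along q a (rmult c x) \<le> c * lower_along q a x"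
    using c by (simp add: field_simps)
qed

text \<open>Subadditivity of the infimum mixes two members q and q'. In a chain one of them lies
  below the other everywhere, and its own subadditivity serves for both. The common upper bound p
  yields the lower bound \<open>- p (\<ominus> x)\<close> that keeps the infimum finite.\<close>

lemma sublinear_INF_chain:
  assumes "C \<noteq> {}" and sub: "\<And>q. q \<in> C \<Longrightarrow> sublinear q"
    and chain: "\<And>q q'. q \<in> C \<Longrightarrow> q' \<in> C \<Longrightarrow>
      (\<forall>x\<in>carrier X. q x \<le> q' x) \<or> (\<forall>x\<in>carrier X. q' x \<le> q x)"
    and upper: "\<And>q x. q \<in> C \<Longrightarrow> x \<in> carrier X \<Longrightarrow> q x \<le> p x"
  shows "sublinear (\<lambda>x. INF q\<in>C. q x)"
    and "\<And>q x. q \<in> C \<Longrightarrow> x \<in> carrier X \<Longrightarrow> (INF q\<in>C. q x) \<le> q x"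
proof -
  show lower: "(INF q\<in>C. q x) \<le> q x" if "q \<in> C" "x \<in> carrier X" for q x
  proof (rule cINF_lower[OF _ that(1)])
    show "bdd_below ((\<lambda>q. q x) ` C)"
    proof (rule bdd_belowI2[of _ "- p (\<ominus> x)"])
      fix q assume "q \<in> C"
      then show "- p (\<ominus> x) \<le> q x"
        using upper[of q "\<ominus> x"] sublinear_lower[OF sub, of q x] that by simp
    qed
  qed
  show "sublinear (\<lambda>x. INF q\<in>C. q x)"
    unfolding sublinear_def
  proof (intro conjI ballI allI impI)
    fix x y assume x: "x \<in> carrier X" and y: "y \<in> carrier X"
    have le: "(INF q\<in>C. q (x \<oplus> y)) \<le> q x + q' y" if "q \<in> C" "q' \<in> C" for q q'
      using chain[OF that]
    proof
      assume "\<forall>x\<in>carrier X. q x \<le> q' x"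
      then have "q y \<le> q' y" using y by simp
      then show ?thesis
        using lower[of q "x \<oplus> y"] that sublinear_add[OF sub[of q] x y] x y by simp
    next
      assume "\<forall>x\<in>carrier X. q' x \<le> q x"
      then have "q' x \<le> q x" using x by simp
      then show ?thesis
        using lower[of q' "x \<oplus> y"] that sublinear_add[OF sub[of q'] x y] x y by simp
    qed
    have "(INF q\<in>C. q (x \<oplus> y)) - q x \<le> (INF q\<in>C. q y)" if "q \<in> C" for q
      by (rule cINF_greatest[OF assms(1)]) (use le[OF that] in \<open>simp add: algebra_simps\<close>)
    then have "(INF q\<in>C. q (x \<oplus> y)) - (INF q\<in>C. q y) \<le> (INF q\<in>C. q x)"
      by (intro cINF_greatest[OF assms(1)]) (simp add: algebra_simps)
    then show "(INF q\<in>C. q (x \<oplus> y)) \<le> (INF q\<in>C. q x) + (INF q\<in>C. q y)" by simp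
  next
    fix c :: real and x assume c: "0 < c" and x: "x \<in> carrier X"
    have "(INF q\<in>C. q (rmult c x)) / c \<le> q x" if "q \<in> C" for q
      using lower[OF that, of "rmult c x"] sublinear_rmult[OF sub[OF that], of c x] c x
      by (simp add: field_simps)
    then have "(INF q\<in>C. q (rmult c x)) / c \<le> (INF q\<in>C. q x)"
      by (rule cINF_greatest[OF assms(1)])
    then show "(INF q\<in>C. q (rmult c x)) \<le> c * (INF q\<in>C. q x)"
      using c by (simp add: field_simps)
  qed
qed

lemma sublinear_cong:
  "sublinear q \<Longrightarrow> (\<And>x. x \<in> carrier X \<Longrightarrow> q' x = q x) \<Longrightarrow> sublinear q'"
  by (simp add: sublinear_def)

lemma minimal_sublinear_exists:
  assumes p: "sublinear p"
  shows "\<exists>m. sublinear m \<and> (\<forall>x\<in>carrier X. m x \<le> p x) \<and>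
    (\<forall>q. sublinear q \<longrightarrow> (\<forall>x\<in>carrier X. q x \<le> m x) \<longrightarrow> (\<forall>x\<in>carrier X. q x = m x))"
proof -
  \<comment> \<open>Restricting to functions vanishing off the carrier makes the pointwise order antisymmetric.\<close>
  define A where "A = {q. sublinear q \<and> (\<forall>x\<in>carrier X. q x \<le> p x) \<and> (\<forall>x. x \<notin> carrier X \<longrightarrow> q x = 0)}"
  define P :: "('a \<Rightarrow> real) \<Rightarrow> ('a \<Rightarrow> real) \<Rightarrow> bool" where "P a b \<longleftrightarrow> (\<forall>x\<in>carrier X. b x \<le> a x)" for a b
  define restr :: "('a \<Rightarrow> real) \<Rightarrow> 'a \<Rightarrow> real" where "restr q x = (if x \<in> carrier X then q x else 0)" for q x
  have restr: "restr q \<in> A" if "sublinear q" "\<And>x. x \<in> carrier X \<Longrightarrow> q x \<le> p x" for q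
    using that sublinear_cong[of q "restr q"] by (auto simp: A_def restr_def)
  have "\<exists>m\<in>A. \<forall>a\<in>A. P m a \<longrightarrow> a = m"
  \<comment> \<open>\<open>P\<close> is the reversed pointwise order, so a maximal element for it is
    a minimal functional. Nonempty chains are bounded by their infimum, the empty one by
    \<open>p\<close>.\<close>
  proof (rule predicate_Zorn)
    show "partial_order_on A (relation_of P A)"
    proof (rule partial_order_on_relation_ofI)
      show "P a a" for a by (simp add: P_def)
      show "P a c" if "P a b" "P b c" for a b c using that unfolding P_def by (meson order_trans)
      show "a = b" if "a \<in> A" "b \<in> A" "P a b" "P b a" for a b
      proof
        fix x show "a x = b x"
          using that unfolding P_def A_def by (cases "x \<in> carrier X") (auto intro: antisym)
      qed
    qed
  next
    fix C assume C: "C \<in> Chains (relation_of P A)"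
    then have CA: "C \<subseteq> A" using Chains_relation_of by blast
    show "\<exists>u\<in>A. \<forall>a\<in>C. P a u"
    proof (cases "C = {}")
      case True
      then show ?thesis using restr[OF p] by auto
    next
      case False
      have chain: "(\<forall>x\<in>carrier X. q x \<le> q' x) \<or> (\<forall>x\<in>carrier X. q' x \<le> q x)"
        if "q \<in> C" "q' \<in> C" for q q'
        using C that unfolding Chains_def relation_of_def P_def by auto
      have sub: "sublinear q" "\<And>x. x \<in> carrier X \<Longrightarrow> q x \<le> p x" if "q \<in> C" for q
        using that CA by (auto simp: A_def)
      have inf: "sublinear (\<lambda>x. INF q\<in>C. q x)"
        "\<And>q x. q \<in> C \<Longrightarrow> x \<in> carrier X \<Longrightarrow> (INF q\<in>C. q x) \<le> q x"
        using sublinear_INF_chain[of C p] False sub chain by blast+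
      obtain q where q: "q \<in> C" using False by auto
      have "restr (\<lambda>x. INF q\<in>C. q x) \<in> A"
        using inf(1) inf(2)[OF q] sub(2)[OF q] by (intro restr) (auto intro: order_trans)
      moreover have "\<forall>a\<in>C. P a (restr (\<lambda>x. INF q\<in>C. q x))"
        using inf(2) by (simp add: P_def restr_def)
      ultimately show ?thesis by blast
    qed
  qed
  then obtain m where m: "m \<in> A" and min: "\<And>a. a \<in> A \<Longrightarrow> P m a \<Longrightarrow> a = m" by blast
  have least: "q x = m x" if "sublinear q" "\<And>x. x \<in> carrier X \<Longrightarrow> q x \<le> m x" "x \<in> carrier X" for q x
  proof -
    have "restr q \<in> A" using that(1,2) m by (intro restr) (force simp: A_def)+
    then have "restr q = m" using min that(2) by (simp add: P_def restr_def)
    then show ?thesis using that(3) by (auto simp: restr_def)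
  qed
  have "sublinear m" "\<And>x. x \<in> carrier X \<Longrightarrow> m x \<le> p x" using m by (auto simp: A_def)
  with least show ?thesis by blast
qed

text \<open>
  The Hahn--Banach argument without extending from subspaces: a minimal sublinear functional
  \<open>m\<close> cannot be lowered along any direction, which forces it to be odd and hence linear.
  Starting from \<^term>\<open>lower_along (nrm X) x\<^sub>0\<close> secures the value at \<open>x\<^sub>0\<close>.
\<close>

lemma real_norming_functional:
  assumes x0: "x0 \<in> carrier X"
  shows "\<exists>m. (\<forall>x\<in>carrier X. \<forall>y\<in>carrier X. m (x \<oplus> y) = m x + m y) \<and>
    (\<forall>t. \<forall>x\<in>carrier X. m (rmult t x) = t * m x) \<and>
    (\<forall>x\<in>carrier X. m x \<le> nrm X x) \<and> m x0 = nrm X x0"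
proof -
  define p where "p = lower_along (nrm X) x0"
  have p: "sublinear p" "\<And>x. x \<in> carrier X \<Longrightarrow> p x \<le> nrm X x" "p (\<ominus> x0) \<le> - nrm X x0"
    using sublinear_lower_along lower_along_le_self lower_along_minus sublinear_nrm x0
    by (auto simp: p_def)
  obtain m where m: "sublinear m" "\<And>x. x \<in> carrier X \<Longrightarrow> m x \<le> p x"
    and min: "\<And>q x. sublinear q \<Longrightarrow> (\<And>x. x \<in> carrier X \<Longrightarrow> q x \<le> m x) \<Longrightarrow> x \<in> carrier X \<Longrightarrow> q x = m x"
    using minimal_sublinear_exists[OF p(1)] by blast
  \<comment> \<open>\<open>lower_along m a\<close> is sublinear and lies below \<open>m\<close>, so
    minimality makes the two equal; evaluating at the negative of \<open>a\<close> gives one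
    inequality, and sublinearity gives the other.\<close>
  have odd: "m (\<ominus> a) = - m a" if a: "a \<in> carrier X" for a
  proof -
    have "lower_along m a (\<ominus> a) = m (\<ominus> a)"
      using a m(1) by (intro min sublinear_lower_along lower_along_le_self) auto
    then have "m (\<ominus> a) \<le> - m a" using lower_along_minus[OF m(1) a] by simp
    then show ?thesis using sublinear_lower[OF m(1) a] by simp
  qed
  have add: "m (x \<oplus> y) = m x + m y" if "x \<in> carrier X" "y \<in> carrier X" for x y
  proof -
    have "(x \<oplus> y) \<oplus> \<ominus> y = x" using that by (simp add: M.a_assoc M.r_neg)
    then have "m x \<le> m (x \<oplus> y) - m y"
      using sublinear_add[OF m(1), of "x \<oplus> y" "\<ominus> y"] odd that by simp
    then show ?thesis using sublinear_add[OF m(1) that] by simp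
  qed
  have hom: "m (rmult t x) = t * m x" if x: "x \<in> carrier X" for t x
  proof (cases "0 \<le> t")
    case True then show ?thesis using sublinear_rmult[OF m(1) _ x] by simp
  next
    case False
    then show ?thesis
      using sublinear_rmult[OF m(1) _ x, of "-t"] odd[of "rmult t x"] x
      by (simp add: rmult_uminus)
  qed
  have le: "m x \<le> nrm X x" if "x \<in> carrier X" for x
    using m(2) p(2) that by (meson order_trans)
  have "nrm X x0 \<le> m x0" using odd[OF x0] m(2)[of "\<ominus> x0"] p(3) x0 by simp
  then have "m x0 = nrm X x0" using le[OF x0] by simp
  with add hom le show ?thesis by blast
qed

text \<open>Only linearity and values in \<open>K\<close> are recorded; the bound by the norm is
  stated separately where it is used.\<close>

definition functional :: "('a \<Rightarrow> complex) \<Rightarrow> bool" where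
  "functional \<phi> \<longleftrightarrow>
    (\<forall>x\<in>carrier X. \<phi> x \<in> K) \<and>
    (\<forall>x\<in>carrier X. \<forall>y\<in>carrier X. \<phi> (x \<oplus> y) = \<phi> x + \<phi> y) \<and>
    (\<forall>c\<in>K. \<forall>x\<in>carrier X. \<phi> (c \<odot> x) = c * \<phi> x)"

text \<open>Over the reals m itself serves. Over the complex numbers this is the usual
  complexification, m(x) - i m(i x).\<close>

lemma functional_with_Re:
  assumes add: "\<And>x y. x \<in> carrier X \<Longrightarrow> y \<in> carrier X \<Longrightarrow> m (x \<oplus> y) = m x + m y"
    and hom: "\<And>t x. x \<in> carrier X \<Longrightarrow> m (rmult t x) = t * m x"
  shows "\<exists>\<phi>. functional \<phi> \<and> (\<forall>x\<in>carrier X. Re (\<phi> x) = m x)"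
proof (cases "K = UNIV")
  case False
  then have K: "K = \<real>" using real_or_complex by simp
  have "complex_of_real (m (c \<odot> x)) = c * complex_of_real (m x)" if "c \<in> K" "x \<in> carrier X" for c x
  proof -
    obtain t where "c = of_real t" using \<open>c \<in> K\<close> K by (auto elim: Reals_cases)
    then show ?thesis using hom[OF \<open>x \<in> carrier X\<close>, of t] by (simp add: rmult_def)
  qed
  then have "functional (\<lambda>x. of_real (m x))"
    by (simp add: functional_def add)
  then show ?thesis by (intro exI[of _ "\<lambda>x. of_real (m x)"]) simp
next
  case True
  define \<phi> where "\<phi> x = Complex (m x) (- m (\<i> \<odot> x))" for x
  have cl [simp]: "c \<odot> x \<in> carrier X" if "x \<in> carrier X" for c x
    using smult_closed[of c x] True that by simp
  have assoc: "a \<odot> (b \<odot> x) = (a * b) \<odot> x" if "x \<in> carrier X" for a b x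
    using smult_assoc1[of a b x] True that by simp
  have dec: "m (c \<odot> x) = Re c * m x + Im c * m (\<i> \<odot> x)" if x: "x \<in> carrier X" for c x
  proof -
    have "c \<odot> x = rmult (Re c) x \<oplus> rmult (Im c) (\<i> \<odot> x)"
      using smult_l_distr[of "of_real (Re c)" "of_real (Im c) * \<i>" x] True x complex_eq[of c]
      by (simp add: rmult_def assoc) (simp add: mult.commute)
    then show ?thesis using x by (simp add: add hom)
  qed
  have "\<phi> (c \<odot> x) = c * \<phi> x" if x: "x \<in> carrier X" for c x
    unfolding \<phi>_def assoc[OF x] dec[OF x, of c] dec[OF x, of "\<i> * c"]
    by (simp add: complex_eq_iff algebra_simps)
  moreover have "\<phi> (x \<oplus> y) = \<phi> x + \<phi> y" if "x \<in> carrier X" "y \<in> carrier X" for x y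
    using that smult_r_distr[of \<i> x y] True by (simp add: \<phi>_def add complex_eq_iff)
  ultimately have "functional \<phi>" unfolding functional_def using True by blast
  then show ?thesis by (intro exI[of _ \<phi>]) (simp add: \<phi>_def)
qed

text \<open>Multiplying x by the conjugate sign of \<phi>(x) makes the value real and nonnegative
  without changing the norm of x, so the bound on real parts applies to the modulus.\<close>

lemma cmod_functional_le:
  assumes \<phi>: "functional \<phi>" and Re: "\<And>x. x \<in> carrier X \<Longrightarrow> Re (\<phi> x) \<le> nrm X x"
    and x: "x \<in> carrier X"
  shows "cmod (\<phi> x) \<le> nrm X x"
proof (cases "\<phi> x = 0")
  case True then show ?thesis using nrm_nonneg[OF x] by simp
next
  case False
  define c where "c = cnj (sgn (\<phi> x))"
  have c: "c \<in> K" using \<phi> x by (auto simp: c_def functional_def)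
  have "c * \<phi> x = of_real (cmod (\<phi> x))"
    using False complex_norm_square[of "\<phi> x"]
    by (simp add: c_def sgn_eq power2_eq_square mult.commute field_simps)
  then have "cmod (\<phi> x) = Re (\<phi> (c \<odot> x))" using \<phi> c x by (simp add: functional_def)
  also have "\<dots> \<le> cmod c * nrm X x" using Re[of "c \<odot> x"] c x nrm_smult[OF c x] by simp
  also have "cmod c = 1" using False by (simp add: c_def norm_sgn)
  finally show ?thesis by simp
qed

lemma norming_functional:
  assumes x0: "x0 \<in> carrier X"
  shows "\<exists>\<phi>. functional \<phi> \<and> (\<forall>x\<in>carrier X. cmod (\<phi> x) \<le> nrm X x) \<and>
    \<phi> x0 = of_real (nrm X x0)"
proof -
  obtain m where m: "\<And>x y. x \<in> carrier X \<Longrightarrow> y \<in> carrier X \<Longrightarrow> m (x \<oplus> y) = m x + m y"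
      "\<And>t x. x \<in> carrier X \<Longrightarrow> m (rmult t x) = t * m x"
    and le: "\<And>x. x \<in> carrier X \<Longrightarrow> m x \<le> nrm X x" and m0: "m x0 = nrm X x0"
    using real_norming_functional[OF x0] by blast
  obtain \<phi> where \<phi>: "functional \<phi>" "\<And>x. x \<in> carrier X \<Longrightarrow> Re (\<phi> x) = m x"
    using functional_with_Re[of m, OF m] by blast
  have bound: "cmod (\<phi> x) \<le> nrm X x" if "x \<in> carrier X" for x
    using cmod_functional_le[OF \<phi>(1) _ that] \<phi>(2) le by simp
  \<comment> \<open>The real part of the value at \<open>x0\<close> already equals the norm, so the
    modulus bound leaves no room for an imaginary part.\<close>
  have "(Re (\<phi> x0))\<^sup>2 + (Im (\<phi> x0))\<^sup>2 \<le> (nrm X x0)\<^sup>2"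
    using power_mono[OF bound[OF x0], of 2] by (simp add: cmod_power2)
  then have "\<phi> x0 = of_real (nrm X x0)"
    using \<phi>(2)[OF x0] m0 by (simp add: complex_eq_iff)
  with \<phi>(1) bound show ?thesis by blast
qed

end

section \<open>Components of a Banach ideal\<close>

locale banach_space_rc = banach_space K X + real_or_complex K
  for K and X :: "'a nspace" (structure)

sublocale banach_space_rc \<subseteq> normed_space_rc ..

lemma scalar_space_simps [simp]:
  "carrier (scalar_space K) = Inl ` K"
  "\<zero>\<^bsub>scalar_space K\<^esub> = Inl 0"
  "x \<oplus>\<^bsub>scalar_space K\<^esub> y = Inl (projl x + projl y)"
  "c \<odot>\<^bsub>scalar_space K\<^esub> x = Inl (c * projl x)"
  "nrm (scalar_space K) x = cmod (projl x)"
  by (simp_all add: scalar_space_def)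

section \<open>The scalar field as a Banach space over itself\<close>

context real_or_complex
begin

lemma normed_space_scalar_space: "normed_space K (scalar_space K :: 'u bspace)"
proof (intro normed_space.intro moduleI normed_space_axioms.intro cring_scalar_ring)
  show "abelian_group (scalar_space K :: 'u bspace)"
  proof (rule abelian_groupI)
    fix x :: "complex + 'u" assume "x \<in> carrier (scalar_space K)"
    then show "\<exists>y\<in>carrier (scalar_space K). y \<oplus>\<^bsub>scalar_space K\<^esub> x = \<zero>\<^bsub>scalar_space K\<^esub>"
      by (intro bexI[of _ "Inl (- projl x)"]) auto
  qed auto
qed (auto simp: algebra_simps norm_mult norm_triangle_ineq)

lemma minus_scalar_space:
  assumes "x \<in> carrier (scalar_space K)" "y \<in> carrier (scalar_space K)"
  shows "x \<ominus>\<^bsub>scalar_space K\<^esub> y = Inl (projl x - projl y)"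
proof -
  interpret normed_space K "scalar_space K" by (rule normed_space_scalar_space)
  have "\<ominus>\<^bsub>scalar_space K\<^esub> y = Inl (- projl y)"
    using assms by (intro M.minus_equality) auto
  then show ?thesis by (simp add: a_minus_def)
qed

text \<open>This admits the scalar field as domain and codomain in the ideal axioms. Completeness
  holds because \<open>K\<close> is closed in the complex plane.\<close>

lemma banach_space_scalar_space: "banach_space K (scalar_space K :: 'u bspace)"
proof (intro banach_space.intro normed_space_scalar_space banach_space_axioms.intro)
  interpret normed_space K "scalar_space K :: 'u bspace"
    by (rule normed_space_scalar_space)
  interpret Metric_space "carrier (scalar_space K)" "ndist (scalar_space K :: 'u bspace)"
    by (rule Metric_space_ndist)
  have dist: "ndist (scalar_space K) x y = dist (projl x) (projl y)"
    if "x \<in> carrier (scalar_space K)" "y \<in> carrier (scalar_space K)" for x y :: "complex + 'u"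
    using that by (simp add: ndist_def minus_scalar_space dist_norm del: scalar_space_simps(1))
  show mcomplete
    unfolding mcomplete_def
  proof (intro allI impI)
    fix \<sigma> :: "nat \<Rightarrow> complex + 'u" assume \<sigma>: "MCauchy \<sigma>"
    then have in_K: "\<sigma> n \<in> carrier (scalar_space K)" for n unfolding MCauchy_def by auto
    have "Cauchy (\<lambda>n. projl (\<sigma> n))"
      using \<sigma> dist[OF in_K in_K] unfolding MCauchy_def Cauchy_def by metis
    then obtain l where l: "(\<lambda>n. projl (\<sigma> n)) \<longlonglongrightarrow> l"
      using Cauchy_convergent_iff convergent_def by blast
    have "projl (\<sigma> n) \<in> K" for n using in_K[of n] by auto
    then have lK: "l \<in> K"
      using closed_sequentially[OF closed_scalars _ l] by simp
    have "limitin mtopology \<sigma> (Inl l) sequentially"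
      unfolding limitin_metric_dist_null
    proof (intro conjI always_eventually allI)
      show "\<sigma> n \<in> carrier (scalar_space K)" for n by (rule in_K)
      show "Inl l \<in> carrier (scalar_space K)" using lK by simp
      then have "ndist (scalar_space K) (\<sigma> n) (Inl l) = dist (projl (\<sigma> n)) l" for n
        using dist[OF in_K, of "Inl l"] by (simp del: scalar_space_simps)
      then show "(\<lambda>n. ndist (scalar_space K) (\<sigma> n) (Inl l)) \<longlonglongrightarrow> 0"
        using iffD1[OF tendsto_dist_iff l] by simp
    qed
    then show "\<exists>x. limitin mtopology \<sigma> x sequentially" ..
  qed
qed

end

text \<open>The constant C bounds the set under the supremum, and the zero vector witnesses that the
  set is nonempty and its supremum nonnegative. Nonnegativity is what later estimates of products of
  operator norms rely on.\<close>

lemma (in normed_space) operator_norm_bounds: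
  assumes T: "\<And>x. x \<in> carrier X \<Longrightarrow> 0 \<le> nrm Y (T x) \<and> nrm Y (T x) \<le> C * nrm X x" and "0 \<le> C"
  shows "0 \<le> operator_norm X Y T" "operator_norm X Y T \<le> C"
proof -
  have C: "nrm Y (T x) \<le> C" if "x \<in> unit_ball X" for x
    using T[of x] that mult_left_le[of "nrm X x" C] \<open>0 \<le> C\<close>
    by (auto simp: unit_ball_def intro: order_trans)
  have zero: "\<zero> \<in> unit_ball X" by (simp add: unit_ball_def)
  show "operator_norm X Y T \<le> C"
    unfolding operator_norm_def using C zero by (intro cSUP_least) auto
  have "nrm Y (T \<zero>) \<le> operator_norm X Y T"
    unfolding operator_norm_def using C zero
    by (intro cSUP_upper) (auto intro: bdd_aboveI2[of _ _ C])
  then show "0 \<le> operator_norm X Y T" using T[OF M.zero_closed] by linarith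
qed

context normed_space_rc
begin

lemma bounded_operator_functional:
  assumes "functional \<phi>" "\<And>x. x \<in> carrier X \<Longrightarrow> cmod (\<phi> x) \<le> nrm X x"
  shows "bounded_operator K X (scalar_space K) (\<lambda>x. Inl (\<phi> x))"
    and "0 \<le> operator_norm X (scalar_space K) (\<lambda>x. Inl (\<phi> x))"
    and "operator_norm X (scalar_space K) (\<lambda>x. Inl (\<phi> x)) \<le> 1"
proof -
  show "bounded_operator K X (scalar_space K) (\<lambda>x. Inl (\<phi> x))"
    using assms unfolding bounded_operator_def functional_def
    by (auto intro: exI[of _ 1])
  show "0 \<le> operator_norm X (scalar_space K) (\<lambda>x. Inl (\<phi> x))"
    "operator_norm X (scalar_space K) (\<lambda>x. Inl (\<phi> x)) \<le> 1"
    using assms(2) by (auto intro!: operator_norm_bounds[where C = 1])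
qed

text \<open>Together with the functionals above, these operators are the outer factors through which
  rank-one mappings pass to and from the product of scalars.\<close>

lemma bounded_operator_vector:
  assumes y: "y \<in> carrier X"
  shows "bounded_operator K (scalar_space K) X (\<lambda>z. projl z \<odot> y)"
    and "0 \<le> operator_norm (scalar_space K) X (\<lambda>z. projl z \<odot> y)"
    and "operator_norm (scalar_space K) X (\<lambda>z. projl z \<odot> y) \<le> nrm X y"
proof -
  interpret S: normed_space K "scalar_space K" by (rule normed_space_scalar_space)
  have "nrm X (projl z \<odot> y) = nrm X y * nrm (scalar_space K) z" if "z \<in> carrier (scalar_space K)" for z
    using that y nrm_smult by auto
  then show "bounded_operator K (scalar_space K) X (\<lambda>z. projl z \<odot> y)"
    unfolding bounded_operator_def using y smult_l_distr[of _ _ y] smult_assoc1[of _ _ y]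
    by (auto intro!: exI[of _ "nrm X y"] simp: nrm_smult)
  have "0 \<le> nrm X (projl z \<odot> y) \<and> nrm X (projl z \<odot> y) \<le> nrm X y * nrm (scalar_space K) z"
    if "z \<in> carrier (scalar_space K)" for z
    using that y nrm_smult nrm_nonneg[OF y] by auto
  then show "0 \<le> operator_norm (scalar_space K) X (\<lambda>z. projl z \<odot> y)"
    "operator_norm (scalar_space K) X (\<lambda>z. projl z \<odot> y) \<le> nrm X y"
    by (rule S.operator_norm_bounds; use nrm_nonneg[OF y] in blast)+
qed

end

locale ideal_component = real_or_complex K for K +
  fixes \<U> :: "('n::finite \<Rightarrow> 'u bspace) \<Rightarrow> 'u bspace \<Rightarrow> ('n, 'u) mapping set"
    and \<nu> :: "('n \<Rightarrow> 'u bspace) \<Rightarrow> 'u bspace \<Rightarrow> ('n, 'u) mapping \<Rightarrow> real"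
    and X :: "'n \<Rightarrow> 'u bspace"
    and Y :: "'u bspace"
  assumes ideal: "banach_ideal K \<U> \<nu>"
    and banach_X: "\<And>i. banach_space K (X i)"
    and banach_Y: "banach_space K Y"
begin

abbreviation V :: "('n, 'u) mapping nspace" where
  "V \<equiv> ideal_space \<U> \<nu> K X Y"

end

sublocale ideal_component \<subseteq> Y: banach_space_rc K Y
  by (intro banach_space_rc.intro banach_Y real_or_complex_axioms)

sublocale ideal_component \<subseteq> X: banach_space_rc K "X i" for i
  by (intro banach_space_rc.intro banach_X real_or_complex_axioms)

text \<open>Mappings thereby become vectors of a Banach space under the ideal norm, so the
  convergence lemma applies to mappings and to points alike.\<close>

sublocale ideal_component \<subseteq> V: banach_space_rc K V
  using ideal banach_X banach_Y
  by (intro banach_space_rc.intro real_or_complex_axioms) (auto simp: banach_ideal_def)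

lemma normed_idealD:
  assumes "normed_ideal K \<U> \<nu>" "\<And>i. banach_space K (X i)" "banach_space K Y"
  shows "submodule (\<U> X Y) (scalar_ring K) (multilinear_space K X Y)"
    and "normed_space K (ideal_space \<U> \<nu> K X Y)"
  using assms unfolding normed_ideal_def by auto

lemma normed_ideal_compose:
  assumes "normed_ideal K \<U> \<nu>" "\<And>i. banach_space K (X i)" "banach_space K Y"
    "\<And>i. banach_space K (Z i)" "banach_space K W"
    "\<And>i. bounded_operator K (Z i) (X i) (T i)" "bounded_operator K Y W S" "\<Phi> \<in> \<U> X Y"
  shows "(\<lambda>z\<in>tuples Z. S (\<Phi> (\<lambda>i. T i (z i)))) \<in> \<U> Z W"
    and "\<nu> Z W (\<lambda>z\<in>tuples Z. S (\<Phi> (\<lambda>i. T i (z i))))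
      \<le> operator_norm Y W S * \<nu> X Y \<Phi> * (\<Prod>i\<in>UNIV. operator_norm (Z i) (X i) (T i))"
  using assms unfolding normed_ideal_def by blast+

lemma normed_ideal_scalar_product:
  assumes "normed_ideal K \<U> \<nu>"
  shows "scalar_product_map K \<in> \<U> (\<lambda>_. scalar_space K) (scalar_space K)"
    and "\<nu> (\<lambda>_. scalar_space K) (scalar_space K) (scalar_product_map K) = 1"
  using assms unfolding normed_ideal_def by auto

lemma ideal_space_simps [simp]:
  "carrier (ideal_space \<U> \<nu> K X Y) = \<U> X Y"
  "nrm (ideal_space \<U> \<nu> K X Y) = \<nu> X Y"
  "\<zero>\<^bsub>ideal_space \<U> \<nu> K X Y\<^esub> = (\<lambda>x\<in>tuples X. \<zero>\<^bsub>Y\<^esub>)"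
  "\<Phi> \<oplus>\<^bsub>ideal_space \<U> \<nu> K X Y\<^esub> \<Psi> = (\<lambda>x\<in>tuples X. \<Phi> x \<oplus>\<^bsub>Y\<^esub> \<Psi> x)"
  "c \<odot>\<^bsub>ideal_space \<U> \<nu> K X Y\<^esub> \<Phi> = (\<lambda>x\<in>tuples X. c \<odot>\<^bsub>Y\<^esub> \<Phi> x)"
  by (simp_all add: ideal_space_def multilinear_space_def)

lemma tuples_iff: "x \<in> tuples X \<longleftrightarrow> (\<forall>i. x i \<in> carrier (X i))"
  by (auto simp: tuples_def)

lemma sphere_tuples_iff:
  "x \<in> sphere_tuples X \<longleftrightarrow> (\<forall>i. x i \<in> carrier (X i) \<and> nrm (X i) (x i) = 1)"
  by (auto simp: sphere_tuples_def unit_sphere_def PiE_iff)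

lemma ball_tuples_iff:
  "x \<in> (\<Pi>\<^sub>E i\<in>UNIV. unit_ball (X i)) \<longleftrightarrow> (\<forall>i. x i \<in> carrier (X i) \<and> nrm (X i) (x i) \<le> 1)"
  by (auto simp: unit_ball_def PiE_iff)

section \<open>Evaluation of mappings and comparison of the ideal norm with pointwise norms\<close>

context ideal_component
begin

lemma normed_ideal: "normed_ideal K \<U> \<nu>"
  using ideal by (simp add: banach_ideal_def)

lemma continuous_multilinear_ideal:
  assumes "\<Phi> \<in> \<U> X Y" shows "continuous_multilinear K X Y \<Phi>"
proof -
  have "submodule (\<U> X Y) (scalar_ring K) (multilinear_space K X Y)"
    by (rule normed_idealD[OF normed_ideal banach_X banach_Y])
  then have "\<U> X Y \<subseteq> carrier (multilinear_space K X Y)"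
    using subgroup.subset submodule.axioms(1) by fastforce
  then show ?thesis using assms by (auto simp: multilinear_space_def)
qed

lemma ideal_closed [simp, intro]: "\<Phi> \<in> \<U> X Y \<Longrightarrow> x \<in> tuples X \<Longrightarrow> \<Phi> x \<in> carrier Y"
  using continuous_multilinear_ideal[of \<Phi>] by (auto simp: continuous_multilinear_def)

text \<open>Addition in \<open>V\<close> is pointwise by definition, whereas subtraction goes
  through the additive inverse of the group. Adding \<Psi> back and cancelling in \<open>Y\<close>
  determines its values.\<close>

lemma minus_ideal_apply:
  assumes \<Phi>: "\<Phi> \<in> \<U> X Y" and \<Psi>: "\<Psi> \<in> \<U> X Y" and x: "x \<in> tuples X"
  shows "(\<Phi> \<ominus>\<^bsub>V\<^esub> \<Psi>) x = \<Phi> x \<ominus>\<^bsub>Y\<^esub> \<Psi> x"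
proof -
  have "((\<Phi> \<ominus>\<^bsub>V\<^esub> \<Psi>) \<oplus>\<^bsub>V\<^esub> \<Psi>) x = \<Phi> x"
    using V.diff_add_cancel[of \<Phi> \<Psi>] \<Phi> \<Psi> by (simp del: ideal_space_simps(4))
  then have "(\<Phi> \<ominus>\<^bsub>V\<^esub> \<Psi>) x \<oplus>\<^bsub>Y\<^esub> \<Psi> x = \<Phi> x" using x by simp
  moreover have "(\<Phi> \<ominus>\<^bsub>V\<^esub> \<Psi>) x \<in> carrier Y"
    using V.minus_closed[of \<Phi> \<Psi>] \<Phi> \<Psi> x by auto
  ultimately show ?thesis
    using \<Phi> \<Psi> x Y.M.add.inv_solve_right[of "(\<Phi> \<ominus>\<^bsub>V\<^esub> \<Psi>) x" "\<Phi> x" "\<Psi> x"]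
    by (simp add: a_minus_def)
qed

text \<open>Homogeneity is available in one coordinate at a time, hence the induction over the set J
  of coordinates already scaled.\<close>

lemma multilinear_smult:
  assumes \<Phi>: "\<Phi> \<in> \<U> X Y" and x: "x \<in> tuples X" and c: "\<And>i. c i \<in> K"
  shows "\<Phi> (\<lambda>i. c i \<odot>\<^bsub>X i\<^esub> x i) = (\<Prod>i\<in>UNIV. c i) \<odot>\<^bsub>Y\<^esub> \<Phi> x"
proof -
  have "\<Phi> (\<lambda>i. if i \<in> J then c i \<odot>\<^bsub>X i\<^esub> x i else x i) = (\<Prod>i\<in>J. c i) \<odot>\<^bsub>Y\<^esub> \<Phi> x" for J
  proof (induction J rule: finite_induct[OF finite])
    case 1
    then show ?case using Y.smult_one[of "\<Phi> x"] \<Phi> x by simp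
  next
    case (2 j J)
    define w where "w i = (if i \<in> J then c i \<odot>\<^bsub>X i\<^esub> x i else x i)" for i
    have w: "w \<in> tuples X" using x c by (auto simp: w_def tuples_iff)
    have upd: "(\<lambda>i. if i \<in> insert j J then c i \<odot>\<^bsub>X i\<^esub> x i else x i) = w(j := c j \<odot>\<^bsub>X j\<^esub> x j)"
      by (auto simp: w_def fun_eq_iff)
    have "\<Phi> (w(j := c j \<odot>\<^bsub>X j\<^esub> x j)) = c j \<odot>\<^bsub>Y\<^esub> \<Phi> (w(j := x j))"
      using continuous_multilinear_ideal[OF \<Phi>] w c x
      unfolding continuous_multilinear_def by (auto simp: tuples_iff)
    also have "w(j := x j) = w" using 2 by (auto simp: w_def)
    also have "\<Phi> w = (\<Prod>i\<in>J. c i) \<odot>\<^bsub>Y\<^esub> \<Phi> x" using 2 unfolding w_def by simp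
    also have "c j \<odot>\<^bsub>Y\<^esub> \<dots> = (\<Prod>i\<in>insert j J. c i) \<odot>\<^bsub>Y\<^esub> \<Phi> x"
      using Y.smult_assoc1[of "c j" "\<Prod>i\<in>J. c i" "\<Phi> x"] c \<Phi> x 2 by (simp add: scalars_prod)
    finally show ?case unfolding upd .
  qed
  from this[of UNIV] show ?thesis by simp
qed

lemma nrm_multilinear_smult:
  assumes "\<Phi> \<in> \<U> X Y" "x \<in> tuples X" "\<And>i. c i \<in> K"
  shows "nrm Y (\<Phi> (\<lambda>i. c i \<odot>\<^bsub>X i\<^esub> x i)) = (\<Prod>i\<in>UNIV. cmod (c i)) * nrm Y (\<Phi> x)"
  using assms multilinear_smult[OF assms] Y.nrm_smult[of "\<Prod>i\<in>UNIV. c i" "\<Phi> x"]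
  by (simp add: scalars_prod prod_norm)

text \<open>
  Composing with \<open>z \<mapsto> z x\<^sub>i\<close> and with a functional norming \<^term>\<open>\<Phi> x\<close> produces a
  multiple of the product of scalars, whose ideal norm is one.
\<close>

lemma nrm_ideal_apply_le:
  assumes \<Phi>: "\<Phi> \<in> \<U> X Y" and x: "x \<in> tuples X"
  shows "nrm Y (\<Phi> x) \<le> \<nu> X Y \<Phi> * (\<Prod>i\<in>UNIV. nrm (X i) (x i))"
proof -
  let ?S = "scalar_space K :: 'u bspace"
  obtain \<phi> where \<phi>: "Y.functional \<phi>" "\<And>y. y \<in> carrier Y \<Longrightarrow> cmod (\<phi> y) \<le> nrm Y y"
    and norming: "\<phi> (\<Phi> x) = of_real (nrm Y (\<Phi> x))"
    using Y.norming_functional[of "\<Phi> x"] \<Phi> x by blast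
  have xi: "x i \<in> carrier (X i)" for i using x by (simp add: tuples_iff)
  define T where "T i = (\<lambda>z :: complex + 'u. projl z \<odot>\<^bsub>X i\<^esub> x i)" for i
  define C where "C = (\<lambda>z\<in>tuples (\<lambda>_::'n. ?S). Inl (\<phi> (\<Phi> (\<lambda>i. T i (z i)))) :: complex + 'u)"
  have op: "bounded_operator K ?S (X i) (T i)" "0 \<le> operator_norm ?S (X i) (T i)"
    "operator_norm ?S (X i) (T i) \<le> nrm (X i) (x i)" for i
    using X.bounded_operator_vector[OF xi] unfolding T_def by auto
  have nn: "0 \<le> \<nu> X Y \<Phi>" using V.nrm_nonneg \<Phi> by simp
  have "\<nu> (\<lambda>_. ?S) ?S C \<le> operator_norm Y ?S (\<lambda>y. Inl (\<phi> y)) * \<nu> X Y \<Phi> *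
      (\<Prod>i\<in>UNIV. operator_norm ?S (X i) (T i))"
    unfolding C_def
    by (intro normed_ideal_compose[OF normed_ideal banach_X banach_Y] banach_space_scalar_space op \<Phi>
        Y.bounded_operator_functional[OF \<phi>])
  also have "\<dots> \<le> (1 * \<nu> X Y \<Phi>) * (\<Prod>i\<in>UNIV. nrm (X i) (x i))"
    using op Y.bounded_operator_functional[OF \<phi>] nn
    by (intro mult_mono mult_right_mono prod_mono prod_nonneg mult_nonneg_nonneg conjI) auto
  finally have le: "\<nu> (\<lambda>_. ?S) ?S C \<le> \<nu> X Y \<Phi> * (\<Prod>i\<in>UNIV. nrm (X i) (x i))" by simp
  interpret P: normed_space K "ideal_space \<U> \<nu> K (\<lambda>_. ?S) ?S"
    by (rule normed_idealD[OF normed_ideal banach_space_scalar_space banach_space_scalar_space])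
  have "C = of_real (nrm Y (\<Phi> x)) \<odot>\<^bsub>ideal_space \<U> \<nu> K (\<lambda>_. ?S) ?S\<^esub> scalar_product_map K"
  proof
    fix z :: "'n \<Rightarrow> complex + 'u"
    show "C z = (of_real (nrm Y (\<Phi> x)) \<odot>\<^bsub>ideal_space \<U> \<nu> K (\<lambda>_. ?S) ?S\<^esub> scalar_product_map K) z"
    proof (cases "z \<in> tuples (\<lambda>_::'n. ?S)")
      case True
      then have z: "projl (z i) \<in> K" for i by (auto simp: tuples_iff) (metis imageE sum.sel(1))
      then have "\<phi> (\<Phi> (\<lambda>i. T i (z i))) = (\<Prod>i\<in>UNIV. projl (z i)) * \<phi> (\<Phi> x)"
        unfolding T_def multilinear_smult[OF \<Phi> x z]
        using \<phi>(1) \<Phi> x by (simp add: Y.functional_def scalars_prod)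
      then show ?thesis using True by (simp add: C_def scalar_product_map_def norming mult.commute)
    qed (simp add: C_def)
  qed
  then have "\<nu> (\<lambda>_. ?S) ?S C = nrm Y (\<Phi> x)"
    using P.nrm_smult[of "of_real (nrm Y (\<Phi> x))" "scalar_product_map K"]
      normed_ideal_scalar_product[OF normed_ideal] Y.nrm_nonneg[of "\<Phi> x"] \<Phi> x
    by (simp del: ideal_space_simps(5))
  then show ?thesis using le by simp
qed

text \<open>This makes the supremum norm finite and dominated by the ideal norm, so convergence in
  the ideal norm is uniform on the unit balls.\<close>

lemma nrm_ideal_apply_le_ball:
  assumes "\<Phi> \<in> \<U> X Y" "x \<in> (\<Pi>\<^sub>E i\<in>UNIV. unit_ball (X i))"
  shows "nrm Y (\<Phi> x) \<le> \<nu> X Y \<Phi>"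
proof -
  have "x \<in> tuples X" using assms by (auto simp: ball_tuples_iff tuples_iff)
  then have "nrm Y (\<Phi> x) \<le> \<nu> X Y \<Phi> * (\<Prod>i\<in>UNIV. nrm (X i) (x i))"
    by (rule nrm_ideal_apply_le[OF assms(1)])
  also have "\<dots> \<le> \<nu> X Y \<Phi> * 1"
    using assms X.nrm_nonneg V.nrm_nonneg[of \<Phi>]
    by (intro mult_left_mono prod_le_1) (auto simp: ball_tuples_iff)
  finally show ?thesis by simp
qed

text \<open>The mapping factors as the functionals, then the product of scalars, then multiplication
  of \<open>y\<close> by a scalar. The product has ideal norm one, so the composition axiom leaves
  only the norm of \<open>y\<close>.\<close>

lemma rank_one_in_ideal:
  assumes \<phi>: "\<And>i. X.functional i (\<phi> i)" "\<And>i x. x \<in> carrier (X i) \<Longrightarrow> cmod (\<phi> i x) \<le> nrm (X i) x"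
    and y: "y \<in> carrier Y"
  shows "(\<lambda>x\<in>tuples X. (\<Prod>i\<in>UNIV. \<phi> i (x i)) \<odot>\<^bsub>Y\<^esub> y) \<in> \<U> X Y"
    and "\<nu> X Y (\<lambda>x\<in>tuples X. (\<Prod>i\<in>UNIV. \<phi> i (x i)) \<odot>\<^bsub>Y\<^esub> y) \<le> nrm Y y"
proof -
  let ?S = "scalar_space K :: 'u bspace"
  define T where "T i = (\<lambda>x. Inl (\<phi> i x) :: complex + 'u)" for i
  define S where "S = (\<lambda>z :: complex + 'u. projl z \<odot>\<^bsub>Y\<^esub> y)"
  have T: "bounded_operator K (X i) ?S (T i)" "0 \<le> operator_norm (X i) ?S (T i)"
    "operator_norm (X i) ?S (T i) \<le> 1" for i
    using X.bounded_operator_functional[OF \<phi>] unfolding T_def by blast+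
  have S: "bounded_operator K ?S Y S" "0 \<le> operator_norm ?S Y S" "operator_norm ?S Y S \<le> nrm Y y"
    using Y.bounded_operator_vector[OF y] unfolding S_def by blast+
  have eq: "(\<lambda>x\<in>tuples X. (\<Prod>i\<in>UNIV. \<phi> i (x i)) \<odot>\<^bsub>Y\<^esub> y)
      = (\<lambda>x\<in>tuples X. S (scalar_product_map K (\<lambda>i. T i (x i))))"
    using \<phi>(1)
    by (auto simp: fun_eq_iff S_def T_def scalar_product_map_def tuples_iff X.functional_def)
  note comp = normed_ideal_compose[OF normed_ideal banach_space_scalar_space banach_space_scalar_space
      banach_X banach_Y T(1) S(1) normed_ideal_scalar_product(1)[OF normed_ideal]]
  show "(\<lambda>x\<in>tuples X. (\<Prod>i\<in>UNIV. \<phi> i (x i)) \<odot>\<^bsub>Y\<^esub> y) \<in> \<U> X Y"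
    unfolding eq by (rule comp(1))
  have "\<nu> X Y (\<lambda>x\<in>tuples X. (\<Prod>i\<in>UNIV. \<phi> i (x i)) \<odot>\<^bsub>Y\<^esub> y)
      \<le> operator_norm ?S Y S * 1 * (\<Prod>i\<in>UNIV. operator_norm (X i) ?S (T i))"
    unfolding eq using comp(2) unfolding normed_ideal_scalar_product(2)[OF normed_ideal] .
  also have "\<dots> \<le> nrm Y y * 1"
    unfolding mult_1_right using S(2,3) T(2,3) Y.nrm_nonneg[OF y]
    by (intro order_trans[OF mult_left_le] prod_le_1) auto
  finally show "\<nu> X Y (\<lambda>x\<in>tuples X. (\<Prod>i\<in>UNIV. \<phi> i (x i)) \<odot>\<^bsub>Y\<^esub> y) \<le> nrm Y y" by simp
qed

end

section \<open>Perturbation to a norm attaining mapping\<close>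

context ideal_component
begin

abbreviation ball_tuples :: "('n \<Rightarrow> complex + 'u) set" where
  "ball_tuples \<equiv> \<Pi>\<^sub>E i\<in>UNIV. unit_ball (X i)"

lemma ball_tuples_subset: "x \<in> ball_tuples \<Longrightarrow> x \<in> tuples X"
  by (auto simp: ball_tuples_iff tuples_iff)

lemma sphere_tuples_subset: "x \<in> sphere_tuples X \<Longrightarrow> x \<in> ball_tuples"
  by (auto simp: ball_tuples_iff sphere_tuples_iff)

lemma zero_in_ball_tuples: "(\<lambda>i. \<zero>\<^bsub>X i\<^esub>) \<in> ball_tuples"
  by (auto simp: ball_tuples_iff X.M.zero_closed)

lemma nrm_le_sup_norm:
  assumes "\<Phi> \<in> \<U> X Y" "x \<in> ball_tuples"
  shows "nrm Y (\<Phi> x) \<le> sup_norm X Y \<Phi>"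
  unfolding sup_norm_def using assms nrm_ideal_apply_le_ball
  by (intro cSUP_upper bdd_aboveI2[of _ _ "\<nu> X Y \<Phi>"]) auto

lemma sup_norm_least:
  "(\<And>x. x \<in> ball_tuples \<Longrightarrow> nrm Y (\<Phi> x) \<le> c) \<Longrightarrow> sup_norm X Y \<Phi> \<le> c"
  unfolding sup_norm_def using zero_in_ball_tuples by (intro cSUP_least) auto

lemma sup_norm_approx:
  assumes "\<Phi> \<in> \<U> X Y" "c < sup_norm X Y \<Phi>"
  obtains x where "x \<in> ball_tuples" "c < nrm Y (\<Phi> x)"
  using assms sup_norm_least[of \<Phi> c] by (meson not_less)

lemma sup_norm_diff_le:
  assumes \<Phi>: "\<Phi> \<in> \<U> X Y" and \<Psi>: "\<Psi> \<in> \<U> X Y"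
  shows "\<bar>sup_norm X Y \<Phi> - sup_norm X Y \<Psi>\<bar> \<le> \<nu> X Y (\<Phi> \<ominus>\<^bsub>V\<^esub> \<Psi>)"
    and "x \<in> ball_tuples \<Longrightarrow> \<bar>nrm Y (\<Phi> x) - nrm Y (\<Psi> x)\<bar> \<le> \<nu> X Y (\<Phi> \<ominus>\<^bsub>V\<^esub> \<Psi>)"
proof -
  have D: "\<Phi> \<ominus>\<^bsub>V\<^esub> \<Psi> \<in> \<U> X Y" using V.minus_closed[of \<Phi> \<Psi>] \<Phi> \<Psi> by simp
  show *: "\<bar>nrm Y (\<Phi> x) - nrm Y (\<Psi> x)\<bar> \<le> \<nu> X Y (\<Phi> \<ominus>\<^bsub>V\<^esub> \<Psi>)" if "x \<in> ball_tuples" for x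
    using Y.nrm_reverse_triangle[of "\<Phi> x" "\<Psi> x"] nrm_ideal_apply_le_ball[OF D that]
      ball_tuples_subset[OF that] \<Phi> \<Psi> by (simp add: minus_ideal_apply)
  have "nrm Y (\<Phi> x) \<le> sup_norm X Y \<Psi> + \<nu> X Y (\<Phi> \<ominus>\<^bsub>V\<^esub> \<Psi>)"
    "nrm Y (\<Psi> x) \<le> sup_norm X Y \<Phi> + \<nu> X Y (\<Phi> \<ominus>\<^bsub>V\<^esub> \<Psi>)" if "x \<in> ball_tuples" for x
    using *[OF that] nrm_le_sup_norm[OF \<Phi> that] nrm_le_sup_norm[OF \<Psi> that] by linarith+
  then have "sup_norm X Y \<Phi> \<le> sup_norm X Y \<Psi> + \<nu> X Y (\<Phi> \<ominus>\<^bsub>V\<^esub> \<Psi>)"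
    "sup_norm X Y \<Psi> \<le> sup_norm X Y \<Phi> + \<nu> X Y (\<Phi> \<ominus>\<^bsub>V\<^esub> \<Psi>)"
    by (auto intro: sup_norm_least)
  then show "\<bar>sup_norm X Y \<Phi> - sup_norm X Y \<Psi>\<bar> \<le> \<nu> X Y (\<Phi> \<ominus>\<^bsub>V\<^esub> \<Psi>)" by linarith
qed

text \<open>A zero coordinate would annihilate the value, so every coordinate can be divided by its
  norm; these norms are at most one, so the value does not decrease. Unimodular factors then make
  the functionals real and nonnegative without affecting any norm.\<close>

lemma normalize_and_rotate:
  assumes \<Phi>: "\<Phi> \<in> \<U> X Y" and x: "x \<in> ball_tuples" and pos: "0 < nrm Y (\<Phi> x)"
    and \<phi>: "\<And>i. X.functional i (\<phi> i)"
  obtains x' where "x' \<in> sphere_tuples X" "nrm Y (\<Phi> x) \<le> nrm Y (\<Phi> x')"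
    "\<And>i. \<phi> i (x' i) = of_real (cmod (\<phi> i (x' i)))"
proof -
  have xt: "x \<in> tuples X" using ball_tuples_subset[OF x] .
  have xi: "x i \<in> carrier (X i)" "nrm (X i) (x i) \<le> 1" for i using x by (auto simp: ball_tuples_iff)
  have "(\<Prod>i\<in>UNIV. nrm (X i) (x i)) \<noteq> 0"
  proof
    assume zero: "(\<Prod>i\<in>UNIV. nrm (X i) (x i)) = 0"
    show False using nrm_ideal_apply_le[OF \<Phi> xt] pos unfolding zero by simp
  qed
  then have "nrm (X i) (x i) \<noteq> 0" for i by simp
  then have n: "0 < nrm (X i) (x i)" for i using X.nrm_nonneg[OF xi(1)] by (simp add: less_le)
  \<comment> \<open>Where the functional vanishes its sign is 0 and could not serve as a unimodular
    factor, hence the value 1.\<close>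
  define u where "u i = (if \<phi> i (x i) = 0 then 1 else cnj (sgn (\<phi> i (x i))))" for i
  define c where "c i = u i / of_real (nrm (X i) (x i))" for i
  have "\<phi> i (x i) \<in> K" for i using \<phi> xi by (simp add: X.functional_def)
  then have "u i \<in> K" for i by (auto simp: u_def)
  then have c: "c i \<in> K" for i by (auto simp: c_def)
  have "cmod (u i) = 1" for i by (simp add: u_def norm_sgn)
  then have cn: "cmod (c i) = 1 / nrm (X i) (x i)" for i
    using n[of i] by (simp add: c_def norm_divide)
  define x' where "x' i = c i \<odot>\<^bsub>X i\<^esub> x i" for i
  have "nrm (X i) (x' i) = 1" for i
    using X.nrm_smult[OF c xi(1)] cn n[of i] by (simp add: x'_def)
  then have "x' \<in> sphere_tuples X" using c xi by (simp add: sphere_tuples_iff x'_def)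
  moreover have "nrm Y (\<Phi> x) \<le> nrm Y (\<Phi> x')"
  proof -
    have "1 \<le> (\<Prod>i\<in>UNIV. cmod (c i))"
      using n xi by (intro prod_ge_1) (simp add: cn)
    then show ?thesis
      unfolding x'_def nrm_multilinear_smult[OF \<Phi> xt c] using pos by simp
  qed
  moreover have "\<phi> i (x' i) = of_real (cmod (\<phi> i (x' i)))" for i
  proof -
    have "u i * \<phi> i (x i) = of_real (cmod (\<phi> i (x i)))"
      using complex_norm_square[of "\<phi> i (x i)"]
      by (simp add: u_def sgn_eq power2_eq_square mult.commute field_simps)
    then have "\<phi> i (x' i) = of_real (cmod (\<phi> i (x i)) / nrm (X i) (x i))"
      using \<phi>[of i] c xi by (simp add: X.functional_def x'_def c_def)
    then show ?thesis using n[of i] by (simp add: norm_divide)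
  qed
  ultimately show ?thesis using that by blast
qed

text \<open>Written with the operations of \<open>V\<close> rather than pointwise, so that \<Phi>
  cancels in the difference and the ideal norm of the added term remains.\<close>

definition perturb :: "real \<Rightarrow> ('n \<Rightarrow> complex + 'u \<Rightarrow> complex) \<Rightarrow> ('n \<Rightarrow> complex + 'u) \<Rightarrow>
    ('n, 'u) mapping \<Rightarrow> ('n, 'u) mapping" where
  "perturb e \<phi> x \<Phi> = \<Phi> \<oplus>\<^bsub>V\<^esub>
    (of_real e \<odot>\<^bsub>V\<^esub> (\<lambda>z\<in>tuples X. (\<Prod>i\<in>UNIV. \<phi> i (z i)) \<odot>\<^bsub>Y\<^esub> \<Phi> x))"

text \<open>The rank-one term points in the direction of \<Phi>(x) itself. At x both summands are
  then nonnegative multiples of one vector and their norms add exactly; elsewhere the triangle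
  inequality is the available bound.\<close>

lemma perturb:
  assumes \<Phi>: "\<Phi> \<in> \<U> X Y" and x: "x \<in> tuples X" and e: "0 < e"
    and \<phi>: "\<And>i. X.functional i (\<phi> i)" "\<And>i x. x \<in> carrier (X i) \<Longrightarrow> cmod (\<phi> i x) \<le> nrm (X i) x"
  shows perturb_in_ideal: "perturb e \<phi> x \<Phi> \<in> \<U> X Y"
    and perturb_minus: "\<nu> X Y (perturb e \<phi> x \<Phi> \<ominus>\<^bsub>V\<^esub> \<Phi>) \<le> e * nrm Y (\<Phi> x)"
    and nrm_perturb_le: "z \<in> tuples X \<Longrightarrow> nrm Y (perturb e \<phi> x \<Phi> z)
      \<le> nrm Y (\<Phi> z) + e * (\<Prod>i\<in>UNIV. cmod (\<phi> i (z i))) * nrm Y (\<Phi> x)"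
    and nrm_perturb_base: "(\<And>i. \<phi> i (x i) = 1) \<Longrightarrow>
      nrm Y (perturb e \<phi> x \<Phi> x) = (1 + e) * nrm Y (\<Phi> x)"
proof -
  let ?R = "\<lambda>z\<in>tuples X. (\<Prod>i\<in>UNIV. \<phi> i (z i)) \<odot>\<^bsub>Y\<^esub> \<Phi> x"
  have y: "\<Phi> x \<in> carrier Y" using \<Phi> x by simp
  note R = rank_one_in_ideal[OF \<phi> y]
  have eR: "of_real e \<odot>\<^bsub>V\<^esub> ?R \<in> carrier V"
    using V.smult_closed[of "of_real e" ?R] R(1) by simp
  show "perturb e \<phi> x \<Phi> \<in> \<U> X Y"
    using V.M.a_closed[OF _ eR, of \<Phi>] \<Phi> unfolding perturb_def by simp
  have "perturb e \<phi> x \<Phi> \<ominus>\<^bsub>V\<^esub> \<Phi> = of_real e \<odot>\<^bsub>V\<^esub> ?R"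
    unfolding perturb_def using V.add_diff_cancel[OF _ eR, of \<Phi>] \<Phi>
    by (simp del: ideal_space_simps(4,5))
  then have "\<nu> X Y (perturb e \<phi> x \<Phi> \<ominus>\<^bsub>V\<^esub> \<Phi>) = e * \<nu> X Y ?R"
    using V.nrm_smult[of "of_real e" ?R] R(1) e by (simp del: ideal_space_simps(5))
  then show "\<nu> X Y (perturb e \<phi> x \<Phi> \<ominus>\<^bsub>V\<^esub> \<Phi>) \<le> e * nrm Y (\<Phi> x)"
    using R(2) e by simp
  have \<phi>K: "(\<Prod>i\<in>UNIV. \<phi> i (z i)) \<in> K" if "z \<in> tuples X" for z
    using \<phi>(1) that by (auto intro!: scalars_prod simp: X.functional_def tuples_iff)
  have eval: "perturb e \<phi> x \<Phi> z
      = \<Phi> z \<oplus>\<^bsub>Y\<^esub> (of_real e * (\<Prod>i\<in>UNIV. \<phi> i (z i))) \<odot>\<^bsub>Y\<^esub> \<Phi> x" if "z \<in> tuples X" for z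
    using that Y.smult_assoc1[of "of_real e" _ "\<Phi> x", OF _ _ y] \<phi>K[OF that]
    by (simp add: perturb_def)
  show "nrm Y (perturb e \<phi> x \<Phi> z)
      \<le> nrm Y (\<Phi> z) + e * (\<Prod>i\<in>UNIV. cmod (\<phi> i (z i))) * nrm Y (\<Phi> x)" if z: "z \<in> tuples X"
  proof -
    have c: "of_real e * (\<Prod>i\<in>UNIV. \<phi> i (z i)) \<in> K"
      using \<phi>K[OF z] by auto
    have "nrm Y (perturb e \<phi> x \<Phi> z)
        \<le> nrm Y (\<Phi> z) + nrm Y ((of_real e * (\<Prod>i\<in>UNIV. \<phi> i (z i))) \<odot>\<^bsub>Y\<^esub> \<Phi> x)"
      unfolding eval[OF z] using c y z \<Phi> by (intro Y.nrm_triangle) auto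
    then show ?thesis
      unfolding Y.nrm_smult[OF c y] using e by (simp add: norm_mult prod_norm)
  qed
  show "nrm Y (perturb e \<phi> x \<Phi> x) = (1 + e) * nrm Y (\<Phi> x)" if "\<And>i. \<phi> i (x i) = 1"
  proof -
    have "perturb e \<phi> x \<Phi> x = of_real (1 + e) \<odot>\<^bsub>Y\<^esub> \<Phi> x"
      unfolding eval[OF x] using Y.smult_l_distr[of 1 "of_real e" "\<Phi> x"] Y.smult_one[OF y] y that
      by simp
    then show ?thesis using Y.nrm_smult[of "of_real (1 + e)" "\<Phi> x"] y e
      by (simp del: of_real_add)
  qed
qed

lemma sphere_norming_functionals:
  assumes x: "x \<in> sphere_tuples X"
  obtains \<phi> where "\<And>i. X.functional i (\<phi> i)" "\<And>i x. x \<in> carrier (X i) \<Longrightarrow> cmod (\<phi> i x) \<le> nrm (X i) x"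
    "\<And>i. \<phi> i (x i) = 1"
proof -
  have "\<forall>i. \<exists>f. X.functional i f \<and> (\<forall>y\<in>carrier (X i). cmod (f y) \<le> nrm (X i) y) \<and> f (x i) = 1"
    using X.norming_functional x unfolding sphere_tuples_iff by (metis of_real_1)
  then obtain \<phi> where \<phi>: "\<And>i. X.functional i (\<phi> i) \<and>
      (\<forall>y\<in>carrier (X i). cmod (\<phi> i y) \<le> nrm (X i) y) \<and> \<phi> i (x i) = 1"
    using choice[of "\<lambda>i f. X.functional i f \<and> (\<forall>y\<in>carrier (X i). cmod (f y) \<le> nrm (X i) y) \<and> f (x i) = 1"]
    by blast
  show ?thesis by (rule that[of \<phi>]) (use \<phi> in blast)+
qed

text \<open>The order of quantifiers carries the iteration: \<eta> depends on \<epsilon> and the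
  spaces alone, and \<theta> may be chosen afterwards as the defect demanded by the next stage. The
  bound 2 on the supremum norm limits the size of the added term.\<close>

lemma perturbation_step:
  assumes convex: "\<And>i. uniformly_convex (X i)" and \<epsilon>: "0 < \<epsilon>"
  shows "\<exists>\<eta>>0. \<forall>\<Phi>\<in>\<U> X Y. \<forall>x\<in>sphere_tuples X. \<forall>\<theta>>0.
    0 < sup_norm X Y \<Phi> \<longrightarrow> sup_norm X Y \<Phi> \<le> 2 \<longrightarrow> (1 - \<eta>) * sup_norm X Y \<Phi> < nrm Y (\<Phi> x) \<longrightarrow>
    (\<exists>\<Phi>'\<in>\<U> X Y. \<exists>x'\<in>sphere_tuples X. \<nu> X Y (\<Phi>' \<ominus>\<^bsub>V\<^esub> \<Phi>) < \<epsilon> \<and>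
      (\<forall>i. nrm (X i) (x' i \<ominus>\<^bsub>X i\<^esub> x i) < \<epsilon>) \<and>
      (1 - \<theta>) * sup_norm X Y \<Phi>' < nrm Y (\<Phi>' x'))"
proof -
  have "\<forall>i. \<exists>\<delta>. 0 < \<delta> \<and> \<delta> < 1 \<and> (\<forall>x1\<in>unit_ball (X i). \<forall>x2\<in>unit_ball (X i).
        nrm (X i) (x1 \<oplus>\<^bsub>X i\<^esub> x2) / 2 > 1 - \<delta> \<longrightarrow> nrm (X i) (x1 \<ominus>\<^bsub>X i\<^esub> x2) < \<epsilon>)"
    using convex \<epsilon> unfolding uniformly_convex_def by blast
  then obtain \<delta> where \<delta>: "\<And>i. 0 < \<delta> i" "\<And>i. \<delta> i < 1"
    "\<And>i x1 x2. x1 \<in> unit_ball (X i) \<Longrightarrow> x2 \<in> unit_ball (X i) \<Longrightarrow>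
      nrm (X i) (x1 \<oplus>\<^bsub>X i\<^esub> x2) / 2 > 1 - \<delta> i \<Longrightarrow> nrm (X i) (x1 \<ominus>\<^bsub>X i\<^esub> x2) < \<epsilon>"
    by metis
  define d where "d = Min (range \<delta>)"
  have d: "0 < d" "d \<le> \<delta> i" for i using \<delta>(1) by (auto simp: d_def)
  have d1: "d < 1" using d(2) \<delta>(2) by (meson le_less_trans)
  \<comment> \<open>The ideal norm of the added term is at most e times 2, which is below
    \<epsilon>; the cap 1 is used to absorb \<eta> e into \<eta>.\<close>
  define e where "e = min 1 (\<epsilon> / 4)"
  have e: "0 < e" "e \<le> 1" "2 * e < \<epsilon>" using \<epsilon> by (auto simp: e_def)
  \<comment> \<open>The loss has four parts of size \<eta>: two from replacing s by a multiple of p,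
    and two from (1 - \<eta>)(1 + e) since e \<le> 1. Their sum must not exceed the share d of the
    gain e.\<close>
  define \<eta> where "\<eta> = e * d / 4"
  have \<eta>: "0 < \<eta>" "\<eta> \<le> 1 / 4" "4 * \<eta> = e * d"
    using e d(1) d1 mult_le_one[of e d] by (auto simp: \<eta>_def)
  show ?thesis
  proof (intro exI[of _ \<eta>] conjI \<eta>(1) ballI allI impI)
    fix \<Phi> x and \<theta> :: real
    assume \<Phi>: "\<Phi> \<in> \<U> X Y" and x: "x \<in> sphere_tuples X" and s0: "0 < sup_norm X Y \<Phi>"
      and s2: "sup_norm X Y \<Phi> \<le> 2" and near: "(1 - \<eta>) * sup_norm X Y \<Phi> < nrm Y (\<Phi> x)"
      and \<theta>0: "0 < \<theta>"
    \<comment> \<open>The point w has to meet the requested tolerance \<theta> and also cost at most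
      \<eta> in the estimate of \<open>P\<close>.\<close>
    define \<theta>' where "\<theta>' = min \<theta> \<eta>"
    have \<theta>': "0 < \<theta>'" "\<theta>' \<le> \<theta>" "\<theta>' \<le> \<eta>" "\<theta>' < 1" using \<theta>0 \<eta> by (auto simp: \<theta>'_def)
    obtain \<phi> where \<phi>: "\<And>i. X.functional i (\<phi> i)"
      "\<And>i x. x \<in> carrier (X i) \<Longrightarrow> cmod (\<phi> i x) \<le> nrm (X i) x" and \<phi>x: "\<And>i. \<phi> i (x i) = 1"
      using sphere_norming_functionals[OF x] by blast
    have xb: "x \<in> ball_tuples" and xt: "x \<in> tuples X"
      using x sphere_tuples_subset ball_tuples_subset by blast+
    note pert = perturb[OF \<Phi> xt e(1) \<phi>]
    define s where "s = sup_norm X Y \<Phi>"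
    define p where "p = nrm Y (\<Phi> x)"
    define \<Phi>' where "\<Phi>' = perturb e \<phi> x \<Phi>"
    define s' where "s' = sup_norm X Y \<Phi>'"
    have \<Phi>': "\<Phi>' \<in> \<U> X Y" using pert(1) by (simp add: \<Phi>'_def)
    have ps: "p \<le> s" using nrm_le_sup_norm[OF \<Phi> xb] by (simp add: p_def s_def)
    have sp: "(1 - \<eta>) * s < p" using near by (simp add: s_def p_def)
    have p0: "0 < p"
      using sp \<eta> s0 mult_pos_pos[of "1 - \<eta>" s] unfolding s_def by linarith
    have s'p: "(1 + e) * p \<le> s'"
      using nrm_le_sup_norm[OF \<Phi>' xb] pert(4)[OF _ \<phi>x] by (simp add: \<Phi>'_def s'_def p_def)
    then have s'0: "0 < s'" using p0 e mult_pos_pos[of "1 + e" p] by linarith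
    have "(1 - \<theta>') * s' < s'" using \<theta>' s'0 by simp
    then obtain w where w: "w \<in> ball_tuples" "(1 - \<theta>') * s' < nrm Y (\<Phi>' w)"
      using sup_norm_approx[OF \<Phi>'] s'_def by blast
    have "0 < (1 - \<theta>') * s'" using \<theta>' s'0 by simp
    then have "0 < nrm Y (\<Phi>' w)" using w by linarith
    then obtain x' where x': "x' \<in> sphere_tuples X" "nrm Y (\<Phi>' w) \<le> nrm Y (\<Phi>' x')"
      and rot: "\<And>i. \<phi> i (x' i) = of_real (cmod (\<phi> i (x' i)))"
      using normalize_and_rotate[OF \<Phi>' w(1) _ \<phi>(1)] by blast
    have x'b: "x' \<in> ball_tuples" and x't: "x' \<in> tuples X"
      using x' sphere_tuples_subset ball_tuples_subset by blast+
    have x'x: "x' i \<in> carrier (X i)" "x i \<in> carrier (X i)" "nrm (X i) (x' i) = 1"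
      "nrm (X i) (x i) = 1" for i
      using x x' by (auto simp: sphere_tuples_iff)
    define P where "P = (\<Prod>i\<in>UNIV. cmod (\<phi> i (x' i)))"
    have "nrm Y (\<Phi>' x') \<le> s + e * P * p"
      using pert(3)[OF _ x't] nrm_le_sup_norm[OF \<Phi> x'b] by (simp add: \<Phi>'_def P_def s_def p_def)
    moreover have "(1 - \<eta>) * ((1 + e) * p) \<le> (1 - \<theta>') * s'"
      using s'p \<theta>' \<eta> s'0 e p0 by (intro mult_mono) auto
    ultimately have "(1 - \<eta>) * ((1 + e) * p) < s + e * P * p" using w(2) x'(2) by linarith
    \<comment> \<open>This inverts the hypothesis (1 - \<eta>) s < p, as (1 + 2 \<eta>)(1 - \<eta>)
      \<ge> 1 for small \<eta>.\<close>
    moreover have "s \<le> (1 + 2 * \<eta>) * p"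
    proof -
      have "1 \<le> (1 + 2 * \<eta>) * (1 - \<eta>)" using \<eta> mult_left_mono[of \<eta> "1/2" \<eta>] by (simp add: algebra_simps)
      then have "1 * s \<le> (1 + 2 * \<eta>) * (1 - \<eta>) * s" using s0 by (intro mult_right_mono) (auto simp: s_def)
      also have "\<dots> = (1 + 2 * \<eta>) * ((1 - \<eta>) * s)" by simp
      also have "\<dots> \<le> (1 + 2 * \<eta>) * p" using sp \<eta> by (intro mult_left_mono) auto
      finally show ?thesis by simp
    qed
    ultimately have "((1 - \<eta>) * (1 + e)) * p < (1 + 2 * \<eta> + e * P) * p" by (simp add: algebra_simps)
    then have "(1 - \<eta>) * (1 + e) < 1 + 2 * \<eta> + e * P" using p0 by simp
    moreover have "\<eta> * e \<le> \<eta>" using \<eta> e by simp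
    ultimately have "e * (1 - d) < e * P" using \<eta>(3) by (simp add: algebra_simps)
    then have P: "1 - d < P" using e by simp
    have close: "nrm (X i) (x' i \<ominus>\<^bsub>X i\<^esub> x i) < \<epsilon>" for i
    proof (rule \<delta>(3))
      show "x' i \<in> unit_ball (X i)" "x i \<in> unit_ball (X i)" using x'x by (auto simp: unit_ball_def)
      have le1: "cmod (\<phi> j (x' j)) \<le> 1" for j using \<phi>(2)[OF x'x(1)] x'x(3) by metis
      \<comment> \<open>All factors are at most one, so a product above 1 - d forces each single
        factor above 1 - d.\<close>
      have "P = cmod (\<phi> i (x' i)) * (\<Prod>j\<in>UNIV - {i}. cmod (\<phi> j (x' j)))"
        unfolding P_def by (rule prod.remove) auto
      also have "\<dots> \<le> cmod (\<phi> i (x' i)) * 1"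
        using le1 by (intro mult_left_mono prod_le_1) auto
      finally have "1 - d < cmod (\<phi> i (x' i))" using P by simp
      \<comment> \<open>The rotation pays off here: both values are nonnegative reals, so they add
        without cancellation and bound the norm of the sum from below.\<close>
      moreover have "\<phi> i (x' i \<oplus>\<^bsub>X i\<^esub> x i) = of_real (cmod (\<phi> i (x' i)) + 1)"
        using \<phi>(1)[of i] x'x \<phi>x rot[of i] by (simp add: X.functional_def)
      then have "cmod (\<phi> i (x' i)) + 1 \<le> nrm (X i) (x' i \<oplus>\<^bsub>X i\<^esub> x i)"
        using \<phi>(2)[of "x' i \<oplus>\<^bsub>X i\<^esub> x i" i] x'x by (simp del: of_real_add)
      ultimately show "1 - \<delta> i < nrm (X i) (x' i \<oplus>\<^bsub>X i\<^esub> x i) / 2"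
        using d(2)[of i] d(1) by simp
    qed
    have "\<nu> X Y (\<Phi>' \<ominus>\<^bsub>V\<^esub> \<Phi>) \<le> e * 2"
    proof -
      have "e * p \<le> e * 2" using ps s2 e by (intro mult_left_mono) (auto simp: s_def)
      then show ?thesis using pert(2) by (simp add: \<Phi>'_def p_def)
    qed
    then have small: "\<nu> X Y (\<Phi>' \<ominus>\<^bsub>V\<^esub> \<Phi>) < \<epsilon>" using e by simp
    have "(1 - \<theta>) * s' \<le> (1 - \<theta>') * s'" using \<theta>' s'0 by (intro mult_right_mono) auto
    then have "(1 - \<theta>) * sup_norm X Y \<Phi>' < nrm Y (\<Phi>' x')"
      using w(2) x'(2) by (simp add: s'_def)
    then show "\<exists>\<Phi>'\<in>\<U> X Y. \<exists>x'\<in>sphere_tuples X. \<nu> X Y (\<Phi>' \<ominus>\<^bsub>V\<^esub> \<Phi>) < \<epsilon> \<and>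
        (\<forall>i. nrm (X i) (x' i \<ominus>\<^bsub>X i\<^esub> x i) < \<epsilon>) \<and>
        (1 - \<theta>) * sup_norm X Y \<Phi>' < nrm Y (\<Phi>' x')"
      by (intro bexI[of _ \<Phi>'] bexI[of _ x'] conjI allI small close \<Phi>' x'(1))
  qed
qed

section \<open>Iteration of the perturbation step and passage to the limit\<close>

lemma sup_norm_nonneg: "\<Phi> \<in> \<U> X Y \<Longrightarrow> 0 \<le> sup_norm X Y \<Phi>"
  using nrm_le_sup_norm[OF _ zero_in_ball_tuples] Y.nrm_nonneg[OF ideal_closed]
    ball_tuples_subset[OF zero_in_ball_tuples] by (meson order_trans)

text \<open>Coordinatewise convergence is convergence in the product topology, which is where
  \<open>continuous_multilinear\<close> places continuity.\<close>

lemma tendsto_nrm_ideal_apply: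
  assumes \<Phi>: "\<Phi> \<in> \<U> X Y" and x: "\<And>k. x k \<in> tuples X"
    and lim: "\<And>i. limitin (ntopology (X i)) (\<lambda>k. x k i) (a i) sequentially"
  shows "(\<lambda>k. nrm Y (\<Phi> (x k))) \<longlonglongrightarrow> nrm Y (\<Phi> a)"
proof -
  have "limitin (product_topology (\<lambda>i. ntopology (X i)) UNIV) x a sequentially"
    unfolding limitin_componentwise using x lim by (auto simp: tuples_iff PiE_UNIV_domain)
  moreover have "continuous_map (product_topology (\<lambda>i. ntopology (X i)) UNIV) (ntopology Y) \<Phi>"
    using continuous_multilinear_ideal[OF \<Phi>] by (simp add: continuous_multilinear_def)
  ultimately have "limitin (ntopology Y) (\<Phi> \<circ> x) (\<Phi> a) sequentially"
    by (rule continuous_map_limit[rotated])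
  then show ?thesis
    using Y.tendsto_nrm[of "\<Phi> \<circ> x" "\<Phi> a"] \<Phi> x by simp
qed

lemma attaining_perturbation:
  assumes convex: "\<And>i. uniformly_convex (X i)" and d: "0 < d" "d \<le> 1 / 2"
  shows "\<exists>\<eta>>0. \<forall>\<Phi>\<in>\<U> X Y. \<forall>x\<in>sphere_tuples X.
    sup_norm X Y \<Phi> = 1 \<longrightarrow> 1 - \<eta> < nrm Y (\<Phi> x) \<longrightarrow>
    (\<exists>\<Psi>\<in>\<U> X Y. \<exists>a\<in>sphere_tuples X. \<nu> X Y (\<Psi> \<ominus>\<^bsub>V\<^esub> \<Phi>) \<le> d \<and>
      (\<forall>i. nrm (X i) (a i \<ominus>\<^bsub>X i\<^esub> x i) \<le> d) \<and> nrm Y (\<Psi> a) = sup_norm X Y \<Psi>)"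
proof -
  \<comment> \<open>The steps r / 2^k sum to 2 r = d, the total displacement allowed.\<close>
  define r where "r = d / 2"
  have r: "0 < r / 2 ^ k" for k :: nat using d by (simp add: r_def)
  have "\<forall>k. \<exists>\<eta>>0. \<forall>\<Phi>\<in>\<U> X Y. \<forall>x\<in>sphere_tuples X. \<forall>\<theta>>0.
    0 < sup_norm X Y \<Phi> \<longrightarrow> sup_norm X Y \<Phi> \<le> 2 \<longrightarrow> (1 - \<eta>) * sup_norm X Y \<Phi> < nrm Y (\<Phi> x) \<longrightarrow>
    (\<exists>\<Phi>'\<in>\<U> X Y. \<exists>x'\<in>sphere_tuples X. \<nu> X Y (\<Phi>' \<ominus>\<^bsub>V\<^esub> \<Phi>) < r / 2 ^ k \<and>
      (\<forall>i. nrm (X i) (x' i \<ominus>\<^bsub>X i\<^esub> x i) < r / 2 ^ k) \<and>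
      (1 - \<theta>) * sup_norm X Y \<Phi>' < nrm Y (\<Phi>' x'))" (is "\<forall>k. \<exists>\<eta>>0. ?S k \<eta>")
    by (intro allI perturbation_step[OF convex r])
  then obtain \<eta> where \<eta>: "\<And>k. 0 < \<eta> k" and step: "\<And>k. ?S k (\<eta> k)"
    by metis
  \<comment> \<open>The first bound meets the hypothesis of stage k; the second lets the defect tend
    to zero, so that the limit attains its norm.\<close>
  define \<theta> where "\<theta> k = min (\<eta> k) (1 / 2 ^ k)" for k
  have \<theta>: "0 < \<theta> k" "\<theta> k \<le> \<eta> k" "\<theta> k \<le> 1 / 2 ^ k" for k using \<eta> by (auto simp: \<theta>_def)
  show ?thesis
  proof (intro exI[of _ "\<theta> 0"] conjI \<theta>(1) ballI impI)
    fix \<Phi> x assume \<Phi>: "\<Phi> \<in> \<U> X Y" and x: "x \<in> sphere_tuples X" and one: "sup_norm X Y \<Phi> = 1"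
      and near: "1 - \<theta> 0 < nrm Y (\<Phi> x)"
    \<comment> \<open>The distance bound stays below d \<le> 1/2 and hence keeps the supremum norms
      between 1/2 and 3/2, inside the range of the step. The clause for k = 0 pins down the start,
      since dependent choice alone would return some initial pair.\<close>
    define P where "P k fz \<longleftrightarrow> fst fz \<in> \<U> X Y \<and> snd fz \<in> sphere_tuples X \<and>
      \<nu> X Y (fst fz \<ominus>\<^bsub>V\<^esub> \<Phi>) \<le> d - d / 2 ^ k \<and>
      (1 - \<theta> k) * sup_norm X Y (fst fz) < nrm Y (fst fz (snd fz)) \<and> (k = 0 \<longrightarrow> fz = (\<Phi>, x))" for k fz
    define Q where "Q k fz gw \<longleftrightarrow> \<nu> X Y (fst gw \<ominus>\<^bsub>V\<^esub> fst fz) \<le> r / 2 ^ k \<and>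
      (\<forall>i. nrm (X i) (snd gw i \<ominus>\<^bsub>X i\<^esub> snd fz i) \<le> r / 2 ^ k)" for k :: nat and fz gw
    have "\<exists>F. \<forall>k. P k (F k) \<and> Q k (F k) (F (Suc k))"
    proof (rule dependent_nat_choice)
      have "\<nu> X Y (\<Phi> \<ominus>\<^bsub>V\<^esub> \<Phi>) = 0"
        using V.diff_self[of \<Phi>] V.nrm_zero \<Phi> by simp
      then show "\<exists>fz. P 0 fz"
        using \<Phi> x one near by (intro exI[of _ "(\<Phi>, x)"]) (simp add: P_def)
    next
      fix fz k assume "P k fz"
      then obtain \<Phi>1 x1 where fz: "fz = (\<Phi>1, x1)" and \<Phi>1: "\<Phi>1 \<in> \<U> X Y" and x1: "x1 \<in> sphere_tuples X"
        and dist: "\<nu> X Y (\<Phi>1 \<ominus>\<^bsub>V\<^esub> \<Phi>) \<le> d - d / 2 ^ k"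
        and near1: "(1 - \<theta> k) * sup_norm X Y \<Phi>1 < nrm Y (\<Phi>1 x1)"
        by (cases fz) (auto simp: P_def)
      have "0 < d / 2 ^ k" using d by simp
      then have s: "0 < sup_norm X Y \<Phi>1" "sup_norm X Y \<Phi>1 \<le> 2"
        using sup_norm_diff_le(1)[OF \<Phi>1 \<Phi>] one dist d by linarith+
      have "(1 - \<eta> k) * sup_norm X Y \<Phi>1 \<le> (1 - \<theta> k) * sup_norm X Y \<Phi>1"
        using \<theta>(2)[of k] s by (intro mult_right_mono) auto
      then have "(1 - \<eta> k) * sup_norm X Y \<Phi>1 < nrm Y (\<Phi>1 x1)" using near1 by linarith
      \<comment> \<open>Stage k is run with tolerance \<theta> at \<open>Suc k\<close>, which is the
        defect that the invariant asks for at the next index.\<close>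
      then obtain \<Phi>2 x2 where *: "\<Phi>2 \<in> \<U> X Y" "x2 \<in> sphere_tuples X"
        "\<nu> X Y (\<Phi>2 \<ominus>\<^bsub>V\<^esub> \<Phi>1) < r / 2 ^ k" "\<And>i. nrm (X i) (x2 i \<ominus>\<^bsub>X i\<^esub> x1 i) < r / 2 ^ k"
        "(1 - \<theta> (Suc k)) * sup_norm X Y \<Phi>2 < nrm Y (\<Phi>2 x2)"
        using step[of k] \<Phi>1 x1 s \<theta>(1)[of "Suc k"] by blast
      have "\<nu> X Y (\<Phi>2 \<ominus>\<^bsub>V\<^esub> \<Phi>) \<le> \<nu> X Y (\<Phi>2 \<ominus>\<^bsub>V\<^esub> \<Phi>1) + \<nu> X Y (\<Phi>1 \<ominus>\<^bsub>V\<^esub> \<Phi>)"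
        using V.nrm_diff_triangle[of \<Phi>2 \<Phi>1 \<Phi>] *(1) \<Phi>1 \<Phi> by simp
      also have "\<dots> \<le> r / 2 ^ k + (d - d / 2 ^ k)" using * dist by simp
      also have "\<dots> = d - d / 2 ^ Suc k" by (simp add: r_def field_simps)
      finally show "\<exists>gw. P (Suc k) gw \<and> Q k fz gw"
        using * by (intro exI[of _ "(\<Phi>2, x2)"]) (simp add: P_def Q_def fz less_imp_le)
    qed
    then obtain F where F: "\<And>k. P k (F k)" "\<And>k. Q k (F k) (F (Suc k))" by blast
    define f where "f k = fst (F k)" for k
    define z where "z k = snd (F k)" for k
    have f: "f k \<in> \<U> X Y" and z: "z k \<in> sphere_tuples X"
      and fz: "(1 - \<theta> k) * sup_norm X Y (f k) < nrm Y (f k (z k))"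
      and f_step: "\<nu> X Y (f (Suc k) \<ominus>\<^bsub>V\<^esub> f k) \<le> r / 2 ^ k"
      and z_step: "nrm (X i) (z (Suc k) i \<ominus>\<^bsub>X i\<^esub> z k i) \<le> r / 2 ^ k" for k i
      using F(1)[of k] F(2)[of k] by (auto simp: P_def Q_def f_def z_def)
    have start: "f 0 = \<Phi>" "z 0 = x" using F(1)[of 0] by (auto simp: P_def f_def z_def)
    have zb: "z k \<in> ball_tuples" and zt: "z k \<in> tuples X" for k
      using z sphere_tuples_subset ball_tuples_subset by blast+
    have z_in: "z k i \<in> carrier (X i)" "nrm (X i) (z k i) = 1" for k i
      using z by (auto simp: sphere_tuples_iff)
    obtain \<Psi> where \<Psi>: "\<Psi> \<in> \<U> X Y" and \<Psi>_dist: "\<And>k. \<nu> X Y (f k \<ominus>\<^bsub>V\<^esub> \<Psi>) \<le> d / 2 ^ k"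
      by (rule V.geometric_convergence[of f r]) (use f f_step in \<open>auto simp: r_def\<close>)
    have "\<exists>b. b \<in> carrier (X i) \<and> limitin (ntopology (X i)) (\<lambda>k. z k i) b sequentially \<and>
        (\<forall>k. nrm (X i) (z k i \<ominus>\<^bsub>X i\<^esub> b) \<le> d / 2 ^ k)" for i
      by (rule X.geometric_convergence[of "\<lambda>k. z k i" i r])
        (use z_in z_step in \<open>auto simp: r_def\<close>)
    then obtain a where a: "\<And>i. a i \<in> carrier (X i)"
        "\<And>i. limitin (ntopology (X i)) (\<lambda>k. z k i) (a i) sequentially"
        "\<And>i k. nrm (X i) (z k i \<ominus>\<^bsub>X i\<^esub> a i) \<le> d / 2 ^ k"
      by metis
    have "nrm (X i) (a i) = 1" for i
      using X.tendsto_nrm[of "\<lambda>k. z k i", OF z_in(1) a(2)] z_in(2)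
      by (simp add: LIMSEQ_const_iff)
    then have a_sphere: "a \<in> sphere_tuples X" using a(1) by (simp add: sphere_tuples_iff)
    define s where "s = sup_norm X Y \<Psi>"
    \<comment> \<open>Two errors d / 2^k occur: one compares the supremum norms of
      \<open>f k\<close> and \<Psi>, the other their values at \<open>z k\<close>. Everything else
      depends on k alone, so both sides pass to the limit.\<close>
    have lower: "(1 - 1 / 2 ^ k) * (s - d / 2 ^ k) - d / 2 ^ k \<le> nrm Y (\<Psi> (z k))" for k
    proof -
      have "(1 - 1 / 2 ^ k) * (s - d / 2 ^ k) \<le> (1 - 1 / 2 ^ k) * sup_norm X Y (f k)"
        using sup_norm_diff_le(1)[OF f[of k] \<Psi>] \<Psi>_dist[of k] by (intro mult_left_mono) (auto simp: s_def)
      also have "\<dots> \<le> (1 - \<theta> k) * sup_norm X Y (f k)"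
        using \<theta>(3)[of k] sup_norm_nonneg[OF f[of k]] by (intro mult_right_mono) auto
      finally show ?thesis
        using fz[of k] sup_norm_diff_le(2)[OF f[of k] \<Psi> zb[of k]] \<Psi>_dist[of k] by linarith
    qed
    have "(\<lambda>k. (1 - 1 / 2 ^ k) * (s - d / 2 ^ k) - d / 2 ^ k) \<longlonglongrightarrow> s"
      by real_asymp
    then have "s \<le> nrm Y (\<Psi> a)"
      using tendsto_nrm_ideal_apply[OF \<Psi> zt a(2)] lower by (intro LIMSEQ_le) auto
    then have attained: "nrm Y (\<Psi> a) = sup_norm X Y \<Psi>"
      using nrm_le_sup_norm[OF \<Psi> sphere_tuples_subset[OF a_sphere]] by (simp add: s_def)
    have "\<nu> X Y (\<Psi> \<ominus>\<^bsub>V\<^esub> \<Phi>) \<le> d"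
      using \<Psi>_dist[of 0] V.nrm_diff_commute[of \<Psi> \<Phi>] \<Psi> \<Phi> start by simp
    moreover have "nrm (X i) (a i \<ominus>\<^bsub>X i\<^esub> x i) \<le> d" for i
      using a(3)[of i 0] X.nrm_diff_commute[OF a(1)[of i] z_in(1)[of 0 i]] start by simp
    ultimately show "\<exists>\<Psi>\<in>\<U> X Y. \<exists>a\<in>sphere_tuples X. \<nu> X Y (\<Psi> \<ominus>\<^bsub>V\<^esub> \<Phi>) \<le> d \<and>
        (\<forall>i. nrm (X i) (a i \<ominus>\<^bsub>X i\<^esub> x i) \<le> d) \<and> nrm Y (\<Psi> a) = sup_norm X Y \<Psi>"
      using \<Psi> a_sphere attained by blast
  qed
qed

text \<open>Dividing by the supremum norm s of the attaining mapping preserves the attaining point.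
  The mapping moves by |1/s - 1| times its ideal norm, and fixing t beforehand bounds that
  norm.\<close>

lemma normalized_attaining_perturbation:
  assumes convex: "\<And>i. uniformly_convex (X i)" and \<epsilon>: "0 < \<epsilon>" and t: "0 < t"
  shows "\<exists>\<eta>>0. \<forall>\<Phi>\<in>\<U> X Y. \<forall>x\<in>sphere_tuples X.
    sup_norm X Y \<Phi> = 1 \<longrightarrow> \<nu> X Y \<Phi> = t \<longrightarrow> nrm Y (\<Phi> x) > 1 - \<eta> \<longrightarrow>
    (\<exists>\<Psi>\<in>\<U> X Y. \<exists>a\<in>sphere_tuples X. sup_norm X Y \<Psi> = 1 \<and> nrm Y (\<Psi> a) = 1 \<and>
      tuple_dist X a x < \<epsilon> \<and> \<nu> X Y (\<Psi> \<ominus>\<^bsub>V\<^esub> \<Phi>) < \<epsilon>)"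
proof -
  \<comment> \<open>With d \<le> 1/2 one has s \<ge> 1/2 and an ideal norm of at most t + 1/2, so
    rescaling costs at most 2 d (t + 1/2). Adding the d already spent gives d (2 t + 2), and the
    denominator 2 t + 4 leaves room for a strict inequality.\<close>
  define d where "d = min (1 / 2) (\<epsilon> / (2 * t + 4))"
  have d: "0 < d" using \<epsilon> t by (simp add: d_def)
  have d_half: "d \<le> 1 / 2" unfolding d_def by (rule min.cobounded1)
  have "d \<le> \<epsilon> / (2 * t + 4)" unfolding d_def by (rule min.cobounded2)
  then have le: "d * (2 * t + 4) \<le> \<epsilon>" using t by (subst (asm) pos_le_divide_eq) auto
  have "0 < d * t" using d t by simp
  then have d\<epsilon>: "d < \<epsilon>" "2 * d * (t + 1 / 2) + d < \<epsilon>"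
    using d le by (simp_all add: algebra_simps)
  obtain \<eta> where \<eta>: "0 < \<eta>" and attaining:
    "\<forall>\<Phi>\<in>\<U> X Y. \<forall>x\<in>sphere_tuples X. sup_norm X Y \<Phi> = 1 \<longrightarrow> 1 - \<eta> < nrm Y (\<Phi> x) \<longrightarrow>
      (\<exists>\<Psi>\<in>\<U> X Y. \<exists>a\<in>sphere_tuples X. \<nu> X Y (\<Psi> \<ominus>\<^bsub>V\<^esub> \<Phi>) \<le> d \<and>
        (\<forall>i. nrm (X i) (a i \<ominus>\<^bsub>X i\<^esub> x i) \<le> d) \<and> nrm Y (\<Psi> a) = sup_norm X Y \<Psi>)"
    using attaining_perturbation[OF convex d d_half] by blast
  show ?thesis
  proof (intro exI[of _ \<eta>] conjI ballI impI \<eta>)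
    fix \<Phi> x assume \<Phi>: "\<Phi> \<in> \<U> X Y" and x: "x \<in> sphere_tuples X" and one: "sup_norm X Y \<Phi> = 1"
      and \<nu>\<Phi>: "\<nu> X Y \<Phi> = t" and near: "1 - \<eta> < nrm Y (\<Phi> x)"
    obtain \<Phi>' a where \<Phi>': "\<Phi>' \<in> \<U> X Y" and a: "a \<in> sphere_tuples X"
      and dist: "\<nu> X Y (\<Phi>' \<ominus>\<^bsub>V\<^esub> \<Phi>) \<le> d" and ax: "\<And>i. nrm (X i) (a i \<ominus>\<^bsub>X i\<^esub> x i) \<le> d"
      and attained: "nrm Y (\<Phi>' a) = sup_norm X Y \<Phi>'"
      using attaining \<Phi> x one near by blast
    define s where "s = sup_norm X Y \<Phi>'"
    have s: "\<bar>s - 1\<bar> \<le> d" using sup_norm_diff_le(1)[OF \<Phi>' \<Phi>] one dist by (simp add: s_def)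
    then have s_ge: "1 / 2 \<le> s" using s d_half by linarith
    define \<Psi> where "\<Psi> = of_real (1 / s) \<odot>\<^bsub>V\<^esub> \<Phi>'"
    have \<Psi>: "\<Psi> \<in> \<U> X Y"
      using V.smult_closed[of "of_real (1 / s)" \<Phi>'] \<Phi>' unfolding \<Psi>_def
      by (simp del: of_real_divide)
    have nrm_\<Psi>: "nrm Y (\<Psi> z) = nrm Y (\<Phi>' z) / s" if "z \<in> tuples X" for z
      using that Y.nrm_smult[OF of_real_in_scalars, of "\<Phi>' z" "1 / s"] \<Phi>' s_ge
      by (simp add: \<Psi>_def norm_divide)
    have ab: "a \<in> ball_tuples" by (rule sphere_tuples_subset[OF a])
    have attained_\<Psi>: "nrm Y (\<Psi> a) = 1"
      using nrm_\<Psi>[OF ball_tuples_subset[OF ab]] attained s_ge by (simp add: s_def)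
    have "nrm Y (\<Psi> z) \<le> 1" if "z \<in> ball_tuples" for z
      using nrm_\<Psi>[OF ball_tuples_subset[OF that]] nrm_le_sup_norm[OF \<Phi>' that] s_ge
      by (simp add: s_def)
    then have "sup_norm X Y \<Psi> \<le> 1" by (rule sup_norm_least)
    then have sup_\<Psi>: "sup_norm X Y \<Psi> = 1"
      using nrm_le_sup_norm[OF \<Psi> ab] attained_\<Psi> by simp
    have "\<nu> X Y (\<Psi> \<ominus>\<^bsub>V\<^esub> \<Phi>') = \<bar>1 / s - 1\<bar> * \<nu> X Y \<Phi>'"
    proof -
      have "\<Psi> \<ominus>\<^bsub>V\<^esub> \<Phi>' = V.rmult (1 / s - 1) \<Phi>'"
        using V.rmult_diff_self[of \<Phi>' "1 / s"] \<Phi>' by (simp add: \<Psi>_def V.rmult_def del: ideal_space_simps(5) of_real_divide of_real_diff)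
      then show ?thesis using V.nrm_rmult[of \<Phi>' "1 / s - 1"] \<Phi>' by simp
    qed
    also have "\<dots> \<le> (2 * d) * (t + 1 / 2)"
    proof (intro mult_mono)
      have "\<bar>1 / s - 1\<bar> = \<bar>s - 1\<bar> / s" using s_ge by (simp add: field_simps abs_if)
      also have "\<dots> \<le> d / (1 / 2)" using s s_ge by (intro frac_le) auto
      finally show "\<bar>1 / s - 1\<bar> \<le> 2 * d" by simp
      show "\<nu> X Y \<Phi>' \<le> t + 1 / 2"
        using V.nrm_reverse_triangle[of \<Phi>' \<Phi>] \<Phi>' \<Phi> dist d_half \<nu>\<Phi> by simp
      show "0 \<le> \<nu> X Y \<Phi>'" using V.nrm_nonneg[of \<Phi>'] \<Phi>' by simp
    qed (use d in simp)
    finally have "\<nu> X Y (\<Psi> \<ominus>\<^bsub>V\<^esub> \<Phi>) < \<epsilon>"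
      using V.nrm_diff_triangle[of \<Psi> \<Phi>' \<Phi>] \<Psi> \<Phi>' \<Phi> dist d\<epsilon> by simp
    moreover have "tuple_dist X a x < \<epsilon>"
      unfolding tuple_dist_def using ax d\<epsilon> by (auto intro: le_less_trans)
    ultimately show "\<exists>\<Psi>\<in>\<U> X Y. \<exists>a\<in>sphere_tuples X. sup_norm X Y \<Psi> = 1 \<and> nrm Y (\<Psi> a) = 1 \<and>
      tuple_dist X a x < \<epsilon> \<and> \<nu> X Y (\<Psi> \<ominus>\<^bsub>V\<^esub> \<Phi>) < \<epsilon>"
      using \<Psi> a sup_\<Psi> attained_\<Psi> by blast
  qed
qed

end

theorem theorem4p4:
  fixes K :: "complex set"
    and \<U> :: "('n::finite \<Rightarrow> 'u bspace) \<Rightarrow> 'u bspace \<Rightarrow> ('n, 'u) mapping set"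
    and \<nu> :: "('n \<Rightarrow> 'u bspace) \<Rightarrow> 'u bspace \<Rightarrow> ('n, 'u) mapping \<Rightarrow> real"
    and X :: "'n \<Rightarrow> 'u bspace"
    and Y :: "'u bspace"
  assumes "K = \<real> \<or> K = UNIV"
    and "banach_ideal K \<U> \<nu>"
    and "\<And>i. banach_space K (X i)"
    and "\<And>i. uniformly_convex (X i)"
    and "banach_space K Y"
  shows "weak_BPBp K \<U> \<nu> X Y"
proof -
  interpret ideal_component K \<U> \<nu> X Y
    using assms by (intro ideal_component.intro real_or_complex.intro ideal_component_axioms.intro)
  let ?good = "\<lambda>\<epsilon> t \<eta>. \<forall>\<Phi>\<in>\<U> X Y. \<forall>x\<in>sphere_tuples X.
    sup_norm X Y \<Phi> = 1 \<longrightarrow> \<nu> X Y \<Phi> = t \<longrightarrow> nrm Y (\<Phi> x) > 1 - \<eta> \<longrightarrow>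
    (\<exists>\<Psi>\<in>\<U> X Y. \<exists>a\<in>sphere_tuples X. sup_norm X Y \<Psi> = 1 \<and> nrm Y (\<Psi> a) = 1 \<and>
      tuple_dist X a x < \<epsilon> \<and> \<nu> X Y (\<Psi> \<ominus>\<^bsub>V\<^esub> \<Phi>) < \<epsilon>)"
  \<comment> \<open>The constant depends only on \<epsilon> and t, so choosing one for each pair
    yields the required function; its value is specified only for positive arguments.\<close>
  define \<eta> where "\<eta> \<epsilon> t = (SOME \<eta>. 0 < \<eta> \<and> ?good \<epsilon> t \<eta>)" for \<epsilon> t
  have \<eta>: "0 < \<eta> \<epsilon> t \<and> ?good \<epsilon> t (\<eta> \<epsilon> t)" if "0 < \<epsilon>" "0 < t" for \<epsilon> t
    unfolding \<eta>_def by (rule someI_ex) (rule normalized_attaining_perturbation[OF assms(4) that])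
  \<comment> \<open>The ideal norm dominates the supremum norm 1, so it is an admissible value of
    t.\<close>
  have pos: "0 < \<nu> X Y \<Phi>" if "\<Phi> \<in> \<U> X Y" "sup_norm X Y \<Phi> = 1" for \<Phi>
    using sup_norm_least[of \<Phi> "\<nu> X Y \<Phi>"] nrm_ideal_apply_le_ball[OF that(1)] that(2) by simp
  show ?thesis
    unfolding weak_BPBp_def
  proof (rule exI[of _ "\<lambda>\<epsilon> t. \<epsilon>"], rule exI[of _ \<eta>], intro conjI)
    show "\<forall>\<epsilon>>0. \<forall>t>0. 0 < \<epsilon> \<and> 0 < \<eta> \<epsilon> t" using \<eta> by blast
    show "\<forall>t>0. ((\<lambda>\<epsilon>. \<epsilon>) \<longlongrightarrow> (0::real)) (at_right 0)" by simp
    show "\<forall>\<epsilon>>0. \<forall>\<Phi>\<in>\<U> X Y. \<forall>x\<in>sphere_tuples X.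
        sup_norm X Y \<Phi> = 1 \<longrightarrow> nrm Y (\<Phi> x) > 1 - \<eta> \<epsilon> (\<nu> X Y \<Phi>) \<longrightarrow>
        (\<exists>\<Psi>\<in>\<U> X Y. \<exists>a\<in>sphere_tuples X. sup_norm X Y \<Psi> = 1 \<and> nrm Y (\<Psi> a) = 1 \<and>
          tuple_dist X a x < \<epsilon> \<and> \<nu> X Y (\<Psi> \<ominus>\<^bsub>V\<^esub> \<Phi>) < \<epsilon>)"
    proof (intro allI ballI impI)
      fix \<epsilon> :: real and \<Phi> x
      assume "0 < \<epsilon>" "\<Phi> \<in> \<U> X Y" "x \<in> sphere_tuples X" "sup_norm X Y \<Phi> = 1"
        "1 - \<eta> \<epsilon> (\<nu> X Y \<Phi>) < nrm Y (\<Phi> x)"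
      then show "\<exists>\<Psi>\<in>\<U> X Y. \<exists>a\<in>sphere_tuples X. sup_norm X Y \<Psi> = 1 \<and> nrm Y (\<Psi> a) = 1 \<and>
          tuple_dist X a x < \<epsilon> \<and> \<nu> X Y (\<Psi> \<ominus>\<^bsub>V\<^esub> \<Phi>) < \<epsilon>"
        using \<eta>[OF _ pos[of \<Phi>], of \<epsilon>] by blast
    qed
  qed
qed

end
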